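(* Assume $\mu$ is strongly irreducible and contracting and satisfies (FE2) and (FE4), and $\mathbb E[\xi(\omega)]\neq0$. Then for every deterministic vector $x\in\mathbb R^d\setminus\{0\}$, \[ \lim_{n\to\infty}\frac1n\,\frac{\langle S_n(\omega)x,\,T_n(\omega)x\rangle}{\|S_n(\omega)x\|_2^2}=\mathbb E[\xi(\omega)]\quad\text{a.s.} \]
   Context: Setup. Fix $d\ge 1$. Let $\lambda$ be a Borel probability measure on $GL(d,\mathbb R)\times M(d,\mathbb R)$, $\Omega=(GL(d,\mathbb R)\times M(d,\mathbb R))^{\mathbb Z}$ with $\mathbb P=\lambda^{\otimes\mathbb Z}$ and $\sigma$ the left shift. Write $\omega_0=(A(\omega),B(\omega))$, $A_n(\omega)=A(\sigma^{n-1}\omega)$, $B_n(\omega)=B(\sigma^{n-1}\omega)$, $n\in\mathbb Z$. $\mu$ is the law of $A_1$. $S_0=I$, $S_n=A_nS_{n-1}$; $T_0=0$, $T_n=B_nS_{n-1}+A_nT_{n-1}$. $S_n^*(\omega)=A_1^*\cdots A_n^*$ ($^*$ = transpose). $\|\cdot\|_2$: Euclidean norm. Strongly irreducible: no finite union of proper subspaces invariant under the closed semigroup $\mathcal S_\mu$ generated by the support of $\mu$. Contracting: some $M_n\in\mathcal S_\mu$ with $M_n/\|M_n\|$ converging to a rank one matrix. (FE2): $\mathbb E[\|B_1A_1^{-1}\|]<\infty$. (FE4): for some $\tau>0$, $\mathbb E[\exp(\tau\,\ell(A_1))]<\infty$, where $\ell(M)=\max\{\log^+\|M\|,\log^+\|M^{-1}\|\}$.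 Random directions $Z(\omega),\widetilde Z(\omega)\in\mathcal P(\mathbb R^d)$: a.s. every limit point of $S_n(\sigma^{-n}\omega)/\|S_n(\sigma^{-n}\omega)\|$ is rank one with range $Z(\omega)$, and every limit point of $S_n^*(\omega)/\|S_n^*(\omega)\|$ is rank one with range $\widetilde Z(\omega)$. $\xi(\omega)=\langle\widetilde z(\sigma\omega),B_1(\omega)z(\omega)\rangle/\langle\widetilde z(\sigma\omega),A_1(\omega)z(\omega)\rangle$ with any representatives $z(\omega)\in Z(\omega)$, $\widetilde z(\sigma\omega)\in\widetilde Z(\sigma\omega)$. *)

theory Defs
  imports "HOL-Probability.Probability"
begin

type_synonym 'd mat = "real^'d^'d"  (* 'd :: finite used below *)

text \<open>Omega = (GL x M)^Z: sample points are functions int => (A,B).\<close>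

definition Amat :: "nat \<Rightarrow> (int \<Rightarrow> ('d::finite) mat \<times> 'd mat) \<Rightarrow> 'd mat" where
  "Amat n \<omega> = fst (\<omega> (int n - 1))"   (* A_n(omega) = A(sigma^(n-1) omega) *)

definition Bmat :: "nat \<Rightarrow> (int \<Rightarrow> ('d::finite) mat \<times> 'd mat) \<Rightarrow> 'd mat" where
  "Bmat n \<omega> = snd (\<omega> (int n - 1))"

definition shift :: "int \<Rightarrow> (int \<Rightarrow> 'a) \<Rightarrow> (int \<Rightarrow> 'a)" where
  "shift k \<omega> = (\<lambda>i. \<omega> (i + k))"   (* shift k = sigma^k *)

primrec Sprod :: "nat \<Rightarrow> (int \<Rightarrow> ('d::finite) mat \<times> 'd mat) \<Rightarrow> 'd mat" where
  "Sprod 0 \<omega> = mat 1"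
| "Sprod (Suc n) \<omega> = Amat (Suc n) \<omega> ** Sprod n \<omega>"

primrec Tsum :: "nat \<Rightarrow> (int \<Rightarrow> ('d::finite) mat \<times> 'd mat) \<Rightarrow> 'd mat" where
  "Tsum 0 \<omega> = 0"
| "Tsum (Suc n) \<omega> = Bmat (Suc n) \<omega> ** Sprod n \<omega> + Amat (Suc n) \<omega> ** Tsum n \<omega>"

text \<open>Euclidean operator norm\<close>
definition opnorm :: "('d::finite) mat \<Rightarrow> real" where
  "opnorm M = onorm (\<lambda>x. M *v x)"

definition logplus :: "real \<Rightarrow> real" where
  "logplus t = max 0 (ln t)"

definition ell :: "('d::finite) mat \<Rightarrow> real" where
  "ell M = max (logplus (opnorm M)) (logplus (opnorm (matrix_inv M)))"

text \<open>law of A_1\<close>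
definition lawA :: "(('d::finite) mat \<times> 'd mat) measure \<Rightarrow> 'd mat measure" where
  "lawA lam = distr lam borel fst"

definition support_of :: "('d::finite) mat measure \<Rightarrow> 'd mat set" where
  "support_of \<mu> = {M. \<forall>U. open U \<and> M \<in> U \<longrightarrow> emeasure \<mu> U > 0}"

text \<open>closed semigroup generated by the support of mu\<close>
definition semigroup_of :: "('d::finite) mat measure \<Rightarrow> 'd mat set" where
  "semigroup_of \<mu> = closure {foldr (**) Ms (mat 1) | Ms. Ms \<noteq> [] \<and> set Ms \<subseteq> support_of \<mu>}"

definition strongly_irreducible :: "('d::finite) mat measure \<Rightarrow> bool" where
  "strongly_irreducible \<mu> \<longleftrightarrow>
     \<not> (\<exists>F. finite F \<and> F \<noteq> {} \<and>
            (\<forall>V\<in>F. subspace V \<and> V \<noteq> {0} \<and> V \<noteq> (UNIV :: (real^'d) set)) \<and>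
            (\<forall>M\<in>semigroup_of \<mu>. (\<lambda>x. M *v x) ` (\<Union>F) \<subseteq> \<Union>F))"

definition contracting :: "('d::finite) mat measure \<Rightarrow> bool" where
  "contracting \<mu> \<longleftrightarrow>
     (\<exists>Ms :: nat \<Rightarrow> 'd mat. \<exists>P. (\<forall>n. Ms n \<in> semigroup_of \<mu>) \<and> rank P = 1 \<and>
        (\<lambda>n. (1 / norm (Ms n)) *\<^sub>R Ms n) \<longlonglongrightarrow> P)"

definition limit_point :: "(nat \<Rightarrow> 'a::topological_space) \<Rightarrow> 'a \<Rightarrow> bool" where
  "limit_point X L \<longleftrightarrow> (\<exists>r. strict_mono r \<and> (X \<circ> r) \<longlonglongrightarrow> L)"

text \<open>Every limit point of X is a rank one matrix with range span {v}\<close>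
definition limits_rank_one_onto :: "(nat \<Rightarrow> ('d::finite) mat) \<Rightarrow> real^'d \<Rightarrow> bool" where
  "limits_rank_one_onto X v \<longleftrightarrow>
     (\<forall>L. limit_point X L \<longrightarrow> rank L = 1 \<and> range (\<lambda>x. L *v x) = span {v})"

end

theory Submission
  imports Defs
begin

text \<open>Write \<open>\<zeta>\<^sub>n = zt (\<sigma>\<^sup>n \<omega>)\<close>. As \<open>\<zeta>\<^sub>n\<close> is proportional to \<open>A\<^sub>n\<^sub>+\<^sub>1\<^sup>* \<zeta>\<^sub>n\<^sub>+\<^sub>1\<close>, the Birkhoff sums of
  \<open>\<xi>\<close> telescope to \<open>\<langle>\<zeta>\<^sub>n, T\<^sub>n z\<rangle> / \<langle>\<zeta>\<^sub>n, S\<^sub>n z\<rangle>\<close>. The denominator is a scalar multiple of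
  \<open>\<langle>\<zeta>\<^sub>0, z\<rangle>\<close>, so the ergodic theorem controls a functional that is linear in \<open>z\<close>; since \<open>z\<close> only
  depends on the past, it can be replaced by any of almost all directions, hence by any vector \<open>x\<close>.
  Finally \<open>\<zeta>\<^sub>n\<close> is independent of \<open>T\<^sub>n x - n E S\<^sub>n x\<close> and charges no hyperplane, so if this vector were
  at least \<open>\<epsilon> n |S\<^sub>n x|\<close> infinitely often, then \<open>\<zeta>\<^sub>n\<close> would detect it with probability bounded
  below. Integrability of \<open>\<xi>\<close> is implicit in its integral being nonzero.\<close>

section \<open>Bernoulli shifts\<close>

text \<open>The obstacle is that \<zeta>_n may be almost orthogonal to S_n x, so the growth of a
  quotient along \<zeta>_n does not by itself control the pairing of T_n x with S_n x. The proof
  therefore aims at the vector statement T_n x = n E S_n x + o(n |S_n x|), from which the claim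
  follows by Cauchy-Schwarz. The lower probability bound must not depend on the vector that
  \<zeta>_n is tested against, since that vector is random and varies with n; compactness of the
  unit sphere makes it uniform. The events for different n are not independent, so the contradiction
  is drawn at the first large deviation after a given time: this event is decided by the coordinates
  below n, the direction of \<zeta>_n by those from n on. \<open>z\<close> and \<open>zt\<close> are
  arbitrary functions, fixed only up to scalars and null sets. They are compared through uniqueness
  of directions, and the irreducibility and deviation arguments take probabilities only of events
  written in terms of the matrices. Independence enters by gluing two samples along a set of
  coordinates, which turns the exchange of pasts or futures into Fubini.\<close>

definition mix :: "int set \<Rightarrow> (int \<Rightarrow> 'a) \<Rightarrow> (int \<Rightarrow> 'a) \<Rightarrow> int \<Rightarrow> 'a" where
  "mix I \<omega> \<omega>' = (\<lambda>i. if i \<in> I then \<omega> i else \<omega>' i)"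

lemma shift_shift: "shift j (shift k \<omega>) = shift (j + k) \<omega>"
  by (simp add: shift_def algebra_simps)

lemma shift_0 [simp]: "shift 0 \<omega> = \<omega>"
  by (simp add: shift_def)

locale bernoulli_shift =
  fixes lam :: "'a measure"
  assumes prob_lam: "prob_space lam" and space_lam: "space lam = UNIV"
begin

abbreviation \<Omega> :: "(int \<Rightarrow> 'a) measure" where
  "\<Omega> \<equiv> PiM UNIV (\<lambda>_. lam)"

lemma space_Omega [simp]: "space \<Omega> = UNIV"
  by (simp add: space_PiM space_lam PiE_UNIV_domain)

sublocale Om: prob_space \<Omega>
  by (intro prob_space_PiM prob_lam)

lemma component_measurable [measurable]: "(\<lambda>\<omega>. \<omega> i) \<in> measurable \<Omega> lam"
  by (rule measurable_component_singleton) simp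

lemma measurable_Omega:
  assumes "\<And>i. (\<lambda>x. f x i) \<in> measurable N lam"
  shows "f \<in> measurable N \<Omega>"
  using measurable_PiM_single'[of UNIV "\<lambda>i x. f x i" N "\<lambda>_. lam"] assms
  by (simp add: space_lam PiE_UNIV_domain)

lemma shift_measurable [measurable]: "shift k \<in> measurable \<Omega> \<Omega>"
  by (rule measurable_Omega) (simp add: shift_def)

lemma mix_measurable [measurable]:
  "(\<lambda>p. mix I (fst p) (snd p)) \<in> measurable (\<Omega> \<Otimes>\<^sub>M \<Omega>) \<Omega>"
  by (rule measurable_Omega) (auto simp: mix_def)

lemma distr_shift: "distr \<Omega> \<Omega> (shift k) = \<Omega>"
  using distr_PiM_reindex[of UNIV "\<lambda>_. lam" "\<lambda>i. i + k" "UNIV :: int set"] prob_lam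
  by (simp add: shift_def[abs_def] inj_on_def restrict_def)

lemma AE_shift: "AE \<omega> in \<Omega>. P \<omega> \<Longrightarrow> AE \<omega> in \<Omega>. P (shift k \<omega>)"
  by (rule AE_distrD[OF shift_measurable]) (subst distr_shift)

lemma AE_all_shift: "AE \<omega> in \<Omega>. P \<omega> \<Longrightarrow> AE \<omega> in \<Omega>. \<forall>k. P (shift k \<omega>)"
  by (simp add: AE_all_countable AE_shift)

lemma integral_shift:
  fixes f :: "_ \<Rightarrow> real"
  assumes "f \<in> borel_measurable \<Omega>"
  shows "(\<integral>\<omega>. f (shift k \<omega>) \<partial>\<Omega>) = (\<integral>\<omega>. f \<omega> \<partial>\<Omega>)"
  using integral_distr[OF shift_measurable[of k] assms] by (simp add: distr_shift)

lemma integrable_shift: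
  fixes f :: "_ \<Rightarrow> real"
  assumes "integrable \<Omega> f"
  shows "integrable \<Omega> (\<lambda>\<omega>. f (shift k \<omega>))"
  using integrable_distr[OF shift_measurable[of k], of f] assms by (simp add: distr_shift)

lemma prob_shift: "A \<in> sets \<Omega> \<Longrightarrow> Om.prob (shift k -` A) = Om.prob A"
  using measure_distr[OF shift_measurable[of k], of A] by (simp add: distr_shift)

text \<open>Finite boxes determine the measure, and the probability of a box is the product of those
  of its parts inside and outside \<open>I\<close>. This is the form in which independence of past
  and future is used.\<close>

lemma distr_mix: "distr (\<Omega> \<Otimes>\<^sub>M \<Omega>) \<Omega> (\<lambda>p. mix I (fst p) (snd p)) = \<Omega>" (is "?L = _")
proof (rule measure_eqI_PiM_infinite[symmetric, OF refl])
  show "finite_measure \<Omega>" by unfold_locales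
  fix J :: "int set" and A :: "int \<Rightarrow> 'a set"
  assume J: "finite J" "J \<subseteq> UNIV" and A: "\<And>i. i \<in> J \<Longrightarrow> A i \<in> sets lam"
  let ?X = "\<lambda>J. prod_emb UNIV (\<lambda>_. lam) J (Pi\<^sub>E J A)"
  have X: "?X K = {\<omega>. \<forall>i\<in>K. \<omega> i \<in> A i}" for K
    by (auto simp: prod_emb_def space_lam PiE_UNIV_domain)
  have s [measurable]: "?X K \<in> sets \<Omega>" if "K \<subseteq> J" for K
    using that J A by (intro sets_PiM_I) (auto intro: finite_subset)
  have pr: "emeasure \<Omega> (?X K) = (\<Prod>i\<in>K. emeasure lam (A i))" if "K \<subseteq> J" for K
    using that J A by (intro emeasure_PiM_emb prob_lam) (auto intro: finite_subset)
  have "emeasure \<Omega> (?X J) = emeasure \<Omega> (?X (J \<inter> I)) * emeasure \<Omega> (?X (J - I))"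
    using J prod.union_disjoint[of "J \<inter> I" "J - I" "\<lambda>i. emeasure lam (A i)"]
    by (subst (1 2 3) pr) (auto simp: Int_Diff_Un Int_Diff_disjoint)
  also have "\<dots> = emeasure (\<Omega> \<Otimes>\<^sub>M \<Omega>) (?X (J \<inter> I) \<times> ?X (J - I))"
    by (intro Om.emeasure_pair_measure_Times[symmetric] s) auto
  also have "?X (J \<inter> I) \<times> ?X (J - I)
      = (\<lambda>p. mix I (fst p) (snd p)) -` ?X J \<inter> space (\<Omega> \<Otimes>\<^sub>M \<Omega>)"
    unfolding X by (auto simp: mix_def space_pair_measure)
  also have "emeasure (\<Omega> \<Otimes>\<^sub>M \<Omega>) \<dots> = emeasure ?L (?X J)"
    by (intro emeasure_distr[symmetric]) auto
  finally show "emeasure \<Omega> (?X J) = emeasure ?L (?X J)" .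
qed simp

text \<open>Fubini for the glued sample. An almost sure property may be nonmeasurable here, which
  allows statements about the arbitrary functions \<open>z\<close> and \<open>zt\<close>.\<close>

lemma AE_mix:
  assumes "AE \<omega> in \<Omega>. P \<omega>"
  shows "AE \<omega> in \<Omega>. AE \<omega>' in \<Omega>. P (mix I \<omega> \<omega>')"
proof -
  have "AE p in \<Omega> \<Otimes>\<^sub>M \<Omega>. P (mix I (fst p) (snd p))"
    by (rule AE_distrD[OF mix_measurable]) (subst distr_mix, fact assms)
  from pair_sigma_finite.AE_pair[OF pair_sigma_finite.intro this] show ?thesis by (simp add: Om.sigma_finite_measure_axioms)
qed

text \<open>The integrand is the conditional probability of \<open>A\<close> given the coordinates
  in \<open>I\<close>.\<close>

lemma integral_mix:
  assumes A [measurable]: "A \<in> sets \<Omega>"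
  shows "(\<lambda>\<omega>. Om.prob {\<omega>'. mix I \<omega> \<omega>' \<in> A}) \<in> borel_measurable \<Omega>"
    and "Om.prob A = (\<integral>\<omega>. Om.prob {\<omega>'. mix I \<omega> \<omega>' \<in> A} \<partial>\<Omega>)"
proof -
  let ?B = "(\<lambda>p. mix I (fst p) (snd p)) -` A \<inter> space (\<Omega> \<Otimes>\<^sub>M \<Omega>)"
  have B [measurable]: "?B \<in> sets (\<Omega> \<Otimes>\<^sub>M \<Omega>)" by measurable
  have eq: "Pair \<omega> -` ?B = {\<omega>'. mix I \<omega> \<omega>' \<in> A}" for \<omega>
    by (auto simp: space_pair_measure)
  have "(\<lambda>\<omega>. emeasure \<Omega> (Pair \<omega> -` ?B)) \<in> borel_measurable \<Omega>"
    by (rule Om.measurable_emeasure_Pair) fact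
  then show m: "(\<lambda>\<omega>. Om.prob {\<omega>'. mix I \<omega> \<omega>' \<in> A}) \<in> borel_measurable \<Omega>"
    unfolding eq measure_def by measurable
  have "emeasure \<Omega> A = emeasure (\<Omega> \<Otimes>\<^sub>M \<Omega>) ?B"
    using emeasure_distr[OF mix_measurable[of I] A] by (simp add: distr_mix)
  also have "\<dots> = (\<integral>\<^sup>+\<omega>. emeasure \<Omega> (Pair \<omega> -` ?B) \<partial>\<Omega>)"
    by (rule Om.emeasure_pair_measure_alt) fact
  also have "\<dots> = (\<integral>\<^sup>+\<omega>. ennreal (Om.prob {\<omega>'. mix I \<omega> \<omega>' \<in> A}) \<partial>\<Omega>)"
    unfolding eq Om.emeasure_eq_measure ..
  also have "\<dots> = ennreal (\<integral>\<omega>. Om.prob {\<omega>'. mix I \<omega> \<omega>' \<in> A} \<partial>\<Omega>)"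
    by (intro nn_integral_eq_integral Om.integrable_const_bound[where B=1] m) auto
  finally show "Om.prob A = (\<integral>\<omega>. Om.prob {\<omega>'. mix I \<omega> \<omega>' \<in> A} \<partial>\<Omega>)"
    by (simp add: Om.emeasure_eq_measure integral_nonneg_AE)
qed

lemma prob_Int_independent:
  assumes A [measurable]: "A \<in> sets \<Omega>" and B [measurable]: "B \<in> sets \<Omega>"
    and "\<And>\<omega> \<omega>'. mix I \<omega> \<omega>' \<in> A \<longleftrightarrow> \<omega> \<in> A" "\<And>\<omega> \<omega>'. mix I \<omega> \<omega>' \<in> B \<longleftrightarrow> \<omega>' \<in> B"
  shows "Om.prob (A \<inter> B) = Om.prob A * Om.prob B"
proof -
  have "Om.prob (A \<inter> B) = (\<integral>\<omega>. Om.prob {\<omega>'. mix I \<omega> \<omega>' \<in> A \<inter> B} \<partial>\<Omega>)"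
    by (rule integral_mix) measurable
  also have "\<dots> = (\<integral>\<omega>. indicator A \<omega> * Om.prob B \<partial>\<Omega>)"
    by (intro Bochner_Integration.integral_cong refl) (auto simp: assms(3,4) indicator_def)
  finally show ?thesis by simp
qed

lemma cylinder_approximation:
  assumes "A \<in> sets \<Omega>" "e > 0"
  shows "\<exists>C J. C \<in> sets \<Omega> \<and> finite J \<and> (\<forall>\<omega> \<omega>'. (\<forall>i\<in>J. \<omega> i = \<omega>' i) \<longrightarrow> (\<omega> \<in> C \<longleftrightarrow> \<omega>' \<in> C))
    \<and> Om.prob (sym_diff A C) < e"
proof -
  define appr where "appr A e C J \<longleftrightarrow> C \<in> sets \<Omega> \<and> finite J
    \<and> (\<forall>\<omega> \<omega>'. (\<forall>i\<in>J. \<omega> i = \<omega>' i) \<longrightarrow> (\<omega> \<in> C \<longleftrightarrow> \<omega>' \<in> C)) \<and> Om.prob (sym_diff A C) < e"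
    for A C and e :: real and J :: "int set"
  have "A \<in> sigma_sets UNIV (prod_algebra UNIV (\<lambda>_::int. lam))"
    using assms(1) unfolding sets_PiM by (simp add: space_lam PiE_UNIV_domain)
  \<comment> \<open>Sets that can be approximated for every \<open>e\<close> form a sigma-algebra
    containing the boxes. Measurability is carried along because the union step uses continuity of
    the measure.\<close>
  then have "A \<in> sets \<Omega> \<and> (\<forall>e>0. \<exists>C J. appr A e C J)"
  proof induction
    case (Basic A)
    then obtain J E where A: "A = prod_emb UNIV (\<lambda>_. lam) J (\<Pi>\<^sub>E j\<in>J. E j)" "finite J"
      "\<And>i. i \<in> J \<Longrightarrow> E i \<in> sets lam"
      by (elim prod_algebraE) auto
    have "A \<in> sets \<Omega>" unfolding A(1) using A(2,3) by (auto intro!: sets_PiM_I)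
    moreover have "A = {\<omega>. \<forall>i\<in>J. \<omega> i \<in> E i}"
      unfolding A(1) by (auto simp: prod_emb_def space_lam PiE_UNIV_domain)
    ultimately show ?case using \<open>finite J\<close> by (auto simp: appr_def intro!: exI[of _ A] exI[of _ J])
  next
    case Empty
    have "appr {} e {} {}" if "e > 0" for e using that by (simp add: appr_def)
    then show ?case by blast
  next
    case (Compl A)
    have "appr (UNIV - A) e (UNIV - C) J" if "appr A e C J" for e C J
    proof -
      have "sym_diff (UNIV - A) (UNIV - C) = sym_diff A C" by auto
      moreover have "UNIV - C \<in> sets \<Omega>"
        using that sets.compl_sets[of C \<Omega>] by (simp add: appr_def)
      ultimately show ?thesis using that by (auto simp: appr_def)
    qed
    moreover have "UNIV - A \<in> sets \<Omega>"
      using Compl sets.compl_sets[of A \<Omega>] by simp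
    ultimately show ?case using Compl by blast
  next
    case (Union F)
    have F [measurable]: "F n \<in> sets \<Omega>" for n using Union by auto
    have "\<exists>C J. appr (\<Union>n. F n) e C J" if e: "e > 0" for e
    proof -
      let ?G = "\<lambda>N. (\<Union>n. F n) - (\<Union>n<N. F n)"
      have "(\<lambda>N. Om.prob (?G N)) \<longlonglongrightarrow> Om.prob (\<Inter>N. ?G N)"
        by (rule Om.finite_Lim_measure_decseq)
          (auto simp: decseq_def)
      moreover have "(\<Inter>N. ?G N) = {}" by auto
      ultimately have "(\<lambda>N. Om.prob (?G N)) \<longlonglongrightarrow> 0" by (simp only: measure_empty)
      from order_tendstoD(2)[OF this, of "e/2"] e
      obtain N where N: "Om.prob (?G N) < e/2"
        by (auto simp: eventually_sequentially)
      \<comment> \<open>Half of \<open>e\<close> is spent on the tail beyond \<open>N\<close>, the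
        other half is divided among the first \<open>N\<close> sets.\<close>
      have "\<forall>n. \<exists>C J. appr (F n) (e / (2 * (real N + 1))) C J"
        using Union e by simp
      then obtain C J where CJ: "\<And>n. appr (F n) (e / (2 * (real N + 1))) (C n) (J n)"
        by metis
      have C [measurable]: "C n \<in> sets \<Omega>" for n using CJ[of n] by (simp add: appr_def)
      have "Om.prob (sym_diff (\<Union>n. F n) (\<Union>n<N. C n))
          \<le> Om.prob (?G N \<union> (\<Union>n<N. sym_diff (F n) (C n)))"
        by (intro Om.finite_measure_mono) auto
      also have "\<dots> \<le> Om.prob (?G N) + Om.prob (\<Union>n<N. sym_diff (F n) (C n))"
        by (intro measure_Un_le) auto
      also have "Om.prob (\<Union>n<N. sym_diff (F n) (C n)) \<le> (\<Sum>n<N. Om.prob (sym_diff (F n) (C n)))"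
        by (intro Om.finite_measure_subadditive_finite) auto
      also have "\<dots> \<le> (\<Sum>n<N. e / (2 * (real N + 1)))"
        using CJ by (intro sum_mono) (auto simp: appr_def intro: less_imp_le)
      also have "\<dots> \<le> e / 2" using e by (simp add: field_simps)
      finally have "Om.prob (sym_diff (\<Union>n. F n) (\<Union>n<N. C n)) < e" using N by simp
      moreover have "\<omega> \<in> (\<Union>n<N. C n) \<longleftrightarrow> \<omega>' \<in> (\<Union>n<N. C n)"
        if "\<forall>i\<in>(\<Union>n<N. J n). \<omega> i = \<omega>' i" for \<omega> \<omega>'
      proof -
        have "\<omega> \<in> C n \<longleftrightarrow> \<omega>' \<in> C n" if "n < N" for n
        proof -
          have "\<forall>i\<in>J n. \<omega> i = \<omega>' i"
            using \<open>\<forall>i\<in>(\<Union>n<N. J n). \<omega> i = \<omega>' i\<close> that by blast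
          with CJ[of n] show ?thesis unfolding appr_def by blast
        qed
        then show ?thesis by simp
      qed
      moreover have "finite (\<Union>n<N. J n)" using CJ by (simp add: appr_def)
      moreover have "(\<Union>n<N. C n) \<in> sets \<Omega>" by measurable
      ultimately have "appr (\<Union>n. F n) e (\<Union>n<N. C n) (\<Union>n<N. J n)"
        unfolding appr_def by blast
      then show ?thesis by blast
    qed
    moreover have "(\<Union>n. F n) \<in> sets \<Omega>" by measurable
    ultimately show ?case by blast
  qed
  then obtain C J where "appr A e C J" using assms(2) by blast
  then show ?thesis unfolding appr_def by blast
qed

text \<open>Mixing: \<open>A\<close> is close to a cylinder event \<open>C\<close>, hence by
  invariance also to its shifts, and a far shift of \<open>C\<close> is independent of
  \<open>C\<close>. Thus P(A) is close to P(C)^2 and so to P(A)^2.\<close>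

lemma invariant_event_0_1:
  assumes A [measurable]: "A \<in> sets \<Omega>" and inv: "\<And>\<omega>. shift 1 \<omega> \<in> A \<longleftrightarrow> \<omega> \<in> A"
  shows "Om.prob A = 0 \<or> Om.prob A = 1"
proof -
  have inv_n: "shift (int n) \<omega> \<in> A \<longleftrightarrow> \<omega> \<in> A" for n \<omega>
  proof (induction n)
    case (Suc n)
    then show ?case using inv[of "shift (int n) \<omega>"] by (simp add: shift_shift)
  qed simp
  have bound: "\<bar>Om.prob A - Om.prob A ^ 2\<bar> \<le> 4 * e" if e: "e > 0" for e
  proof -
    obtain C J where C [measurable]: "C \<in> sets \<Omega>" and J: "finite J"
      and CJ: "\<And>\<omega> \<omega>'. (\<forall>i\<in>J. \<omega> i = \<omega>' i) \<Longrightarrow> (\<omega> \<in> C \<longleftrightarrow> \<omega>' \<in> C)"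
      and d: "Om.prob (sym_diff A C) < e"
      using cylinder_approximation[OF A e] by blast
    have "bdd_above ((\<lambda>(i, j). i - j) ` (J \<times> J))" using J by simp
    then obtain b where b: "\<And>x. x \<in> (\<lambda>(i, j). i - j) ` (J \<times> J) \<Longrightarrow> x \<le> b"
      unfolding bdd_above_def by blast
    \<comment> \<open>\<open>m\<close> exceeds every difference of two coordinates in
      \<open>J\<close>, so the translate of \<open>J\<close> by the \<open>n\<close> below misses
      \<open>J\<close>.\<close>
    define m where "m = b + 1"
    have m: "i - j < m" if "i \<in> J" "j \<in> J" for i j
      using b[of "i - j"] that by (force simp: m_def)
    define n where "n = nat m"
    have dj: "j + int n \<notin> J" if "j \<in> J" for j
      using m[of "j + int n" j] m[of j j] that by (auto simp: n_def)
    define D where "D = shift (int n) -` C"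
    have D [measurable]: "D \<in> sets \<Omega>"
      using measurable_sets[OF shift_measurable C, of "int n"] by (simp add: D_def)
    have pD: "Om.prob D = Om.prob C" unfolding D_def by (rule prob_shift) fact
    have pCD: "Om.prob (C \<inter> D) = Om.prob C * Om.prob D"
    proof (rule prob_Int_independent[where I=J])
      show "mix J \<omega> \<omega>' \<in> C \<longleftrightarrow> \<omega> \<in> C" for \<omega> \<omega>'
        by (rule CJ) (simp add: mix_def)
      show "mix J \<omega> \<omega>' \<in> D \<longleftrightarrow> \<omega>' \<in> D" for \<omega> \<omega>'
        unfolding D_def vimage_eq by (rule CJ) (use dj in \<open>auto simp: mix_def shift_def\<close>)
    qed measurable
    have dD: "Om.prob (sym_diff A D) < e"
    proof -
      have "sym_diff A D = shift (int n) -` (sym_diff A C)"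
        using inv_n by (auto simp: D_def)
      then have "Om.prob (sym_diff A D) = Om.prob (sym_diff A C)"
        using prob_shift[of "sym_diff A C" "int n"] by simp
      with d show ?thesis by simp
    qed
    have close: "\<bar>Om.prob X - Om.prob Y\<bar> \<le> Om.prob (sym_diff X Y)"
      if [measurable]: "X \<in> sets \<Omega>" "Y \<in> sets \<Omega>" for X Y
    proof -
      have "Om.prob X \<le> Om.prob (Y \<union> sym_diff X Y)" "Om.prob Y \<le> Om.prob (X \<union> sym_diff X Y)"
        by (intro Om.finite_measure_mono; auto)+
      moreover have "Om.prob (Y \<union> sym_diff X Y) \<le> Om.prob Y + Om.prob (sym_diff X Y)"
        "Om.prob (X \<union> sym_diff X Y) \<le> Om.prob X + Om.prob (sym_diff X Y)"
        by (intro measure_Un_le; measurable)+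
      ultimately show ?thesis by linarith
    qed
    have "\<bar>Om.prob A - Om.prob (C \<inter> D)\<bar> \<le> Om.prob (sym_diff A (C \<inter> D))"
      by (rule close) measurable
    also have "\<dots> \<le> Om.prob (sym_diff A C \<union> sym_diff A D)"
      by (intro Om.finite_measure_mono) auto
    also have "\<dots> \<le> Om.prob (sym_diff A C) + Om.prob (sym_diff A D)"
      by (intro measure_Un_le) measurable
    finally have 1: "\<bar>Om.prob A - Om.prob C * Om.prob C\<bar> \<le> 2 * e"
      using d dD pCD pD by simp
    have cA: "\<bar>Om.prob A - Om.prob C\<bar> \<le> e"
      using close[OF A C] d by simp
    have "Om.prob A ^ 2 - Om.prob C * Om.prob C
        = (Om.prob A + Om.prob C) * (Om.prob A - Om.prob C)"
      by (simp add: power2_eq_square algebra_simps)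
    then have "\<bar>Om.prob A ^ 2 - Om.prob C * Om.prob C\<bar>
        = (Om.prob A + Om.prob C) * \<bar>Om.prob A - Om.prob C\<bar>"
      by (simp add: abs_mult)
    also have "\<dots> \<le> 2 * e"
    proof (intro mult_mono cA)
      show "Om.prob A + Om.prob C \<le> 2"
        using Om.prob_le_1[of A] Om.prob_le_1[of C] by linarith
    qed auto
    finally show ?thesis using 1 by linarith
  qed
  have "\<bar>Om.prob A - Om.prob A ^ 2\<bar> \<le> 0"
  proof (rule field_le_epsilon)
    fix e :: real assume "e > 0"
    then show "\<bar>Om.prob A - Om.prob A ^ 2\<bar> \<le> 0 + e" using bound[of "e/4"] by simp
  qed
  then have "Om.prob A * (1 - Om.prob A) = 0"
    by (simp add: power2_eq_square algebra_simps)
  then show ?thesis by auto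
qed

section \<open>The ergodic theorem for Bernoulli shifts\<close>

text \<open>The maximum over j <= n of the sums of \<open>f\<close> over the first j points of the
  orbit, with the empty sum 0. Splitting off the first point instead of the last relates it to the
  same maximum at the shifted sample.\<close>

primrec maxsum :: "((int \<Rightarrow> 'a) \<Rightarrow> real) \<Rightarrow> nat \<Rightarrow> (int \<Rightarrow> 'a) \<Rightarrow> real" where
  "maxsum f 0 \<omega> = 0"
| "maxsum f (Suc n) \<omega> = max 0 (f \<omega> + maxsum f n (shift 1 \<omega>))"

lemma maxsum_nonneg: "maxsum f n \<omega> \<ge> 0"
  by (cases n) auto

lemma maxsum_mono: "m \<le> n \<Longrightarrow> maxsum f m \<omega> \<le> maxsum f n \<omega>"
proof -
  have "maxsum f n \<omega> \<le> maxsum f (Suc n) \<omega>" for n \<omega>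
  proof (induction n arbitrary: \<omega>)
    case (Suc n)
    have "maxsum f (Suc (Suc n)) \<omega> = max 0 (f \<omega> + maxsum f (Suc n) (shift 1 \<omega>))"
      by (rule maxsum.simps)
    moreover have "maxsum f (Suc n) \<omega> = max 0 (f \<omega> + maxsum f n (shift 1 \<omega>))"
      by (rule maxsum.simps)
    ultimately show ?case by (simp only:) (intro max.mono add_left_mono Suc order_refl)
  qed simp
  then show "m \<le> n \<Longrightarrow> maxsum f m \<omega> \<le> maxsum f n \<omega>" by (rule lift_Suc_mono_le)
qed

lemma sum_le_maxsum: "(\<Sum>k<n. f (shift (int k) \<omega>)) \<le> maxsum f n \<omega>"
proof (induction n arbitrary: \<omega>)
  case (Suc n)
  show ?case using Suc[of "shift 1 \<omega>"]
    by (simp add: sum.lessThan_Suc_shift shift_shift algebra_simps del: sum.lessThan_Suc)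
qed simp

lemma integrable_maxsum:
  assumes "integrable \<Omega> f"
  shows "integrable \<Omega> (maxsum f n)"
proof (induction n)
  case 0
  then show ?case by (simp add: maxsum.simps[abs_def])
next
  case (Suc n)
  then show ?case using assms integrable_shift[OF Suc, of 1] by (simp add: maxsum.simps[abs_def])
qed

text \<open>If the maximal sums were unbounded with positive probability, then almost surely, so that
  \<^term>\<open>maxsum f (Suc n) \<omega> - maxsum f n (shift 1 \<omega>)\<close>, which has nonnegative mean, would tend
  to \<^term>\<open>f \<omega>\<close>.\<close>
lemma maxsum_bounded:
  assumes f: "integrable \<Omega> f" and neg: "(\<integral>\<omega>. f \<omega> \<partial>\<Omega>) < 0"
  shows "AE \<omega> in \<Omega>. \<exists>C. \<forall>n. maxsum f n \<omega> \<le> C"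
proof -
  have [measurable]: "maxsum f n \<in> borel_measurable \<Omega>" for n
    using integrable_maxsum[OF f] by auto
  have fm [measurable]: "f \<in> borel_measurable \<Omega>" using f by auto
  define A where "A = {\<omega>. \<forall>k::nat. \<exists>n. real k < maxsum f n \<omega>}"
  have A [measurable]: "A \<in> sets \<Omega>"
  proof -
    have "{\<omega> \<in> space \<Omega>. \<forall>k::nat. \<exists>n. real k < maxsum f n \<omega>} \<in> sets \<Omega>" by measurable
    then show ?thesis by (simp add: A_def)
  qed
  have A': "\<omega> \<in> A \<longleftrightarrow> (\<forall>K. \<exists>n. K < maxsum f n \<omega>)" for \<omega>
    unfolding A_def using reals_Archimedean2 by (fastforce intro: less_trans)
  have "shift 1 \<omega> \<in> A \<longleftrightarrow> \<omega> \<in> A" for \<omega>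
  proof
    assume a: "shift 1 \<omega> \<in> A"
    show "\<omega> \<in> A" unfolding A'
    proof
      fix K
      obtain n where "K - f \<omega> < maxsum f n (shift 1 \<omega>)" using a unfolding A' by blast
      then show "\<exists>n. K < maxsum f n \<omega>" by (intro exI[of _ "Suc n"]) auto
    qed
  next
    assume a: "\<omega> \<in> A"
    show "shift 1 \<omega> \<in> A" unfolding A'
    proof
      fix K
      \<comment> \<open>The maximum with 0 forces \<open>n\<close> to be a successor, so that the
        recursion applies.\<close>
      obtain n where n: "max 0 (f \<omega> + K) < maxsum f n \<omega>" using a unfolding A' by blast
      then obtain m where "n = Suc m" by (cases n) auto
      with n show "\<exists>n. K < maxsum f n (shift 1 \<omega>)" by auto
    qed
  qed
  from invariant_event_0_1[OF A this] have "Om.prob A = 0 \<or> Om.prob A = 1" .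
  moreover have "Om.prob A \<noteq> 1"
  proof
    assume "Om.prob A = 1"
    then have AE_A: "AE \<omega> in \<Omega>. shift 1 \<omega> \<in> A"
      by (intro AE_shift) (simp add: Om.prob_eq_1)
    let ?d = "\<lambda>n \<omega>. maxsum f (Suc n) \<omega> - maxsum f n (shift 1 \<omega>)"
    have "(\<lambda>n. \<integral>\<omega>. ?d n \<omega> \<partial>\<Omega>) \<longlonglongrightarrow> (\<integral>\<omega>. f \<omega> \<partial>\<Omega>)"
    proof (rule integral_dominated_convergence)
      show "integrable \<Omega> (\<lambda>\<omega>. \<bar>f \<omega>\<bar>)" using f by simp
      \<comment> \<open>By the recursion \<open>?d n \<omega>\<close> is the maximum of
        \<open>f \<omega>\<close> and a nonpositive number.\<close>
      show "AE \<omega> in \<Omega>. norm (?d n \<omega>) \<le> \<bar>f \<omega>\<bar>" for n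
      proof (rule AE_I2)
        fix \<omega>
        show "norm (?d n \<omega>) \<le> \<bar>f \<omega>\<bar>" using maxsum_nonneg[of f n "shift 1 \<omega>"] by auto
      qed
      show "AE \<omega> in \<Omega>. (\<lambda>n. ?d n \<omega>) \<longlonglongrightarrow> f \<omega>"
        using AE_A
      proof eventually_elim
        case (elim \<omega>)
        then obtain n where n: "- f \<omega> < maxsum f n (shift 1 \<omega>)" unfolding A' by blast
        have "?d m \<omega> = f \<omega>" if "m \<ge> n" for m
          using maxsum_mono[OF that, of f "shift 1 \<omega>"] n by auto
        then show ?case
          by (intro tendsto_eventually) (auto simp: eventually_sequentially)
      qed
    qed measurable
    moreover have "(\<integral>\<omega>. ?d n \<omega> \<partial>\<Omega>) \<ge> 0" for n
    proof -
      have "(\<integral>\<omega>. ?d n \<omega> \<partial>\<Omega>) = (\<integral>\<omega>. maxsum f (Suc n) \<omega> \<partial>\<Omega>) - (\<integral>\<omega>. maxsum f n (shift 1 \<omega>) \<partial>\<Omega>)"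
        by (intro Bochner_Integration.integral_diff integrable_maxsum f integrable_shift)
      moreover have "(\<integral>\<omega>. maxsum f n (shift 1 \<omega>) \<partial>\<Omega>) = (\<integral>\<omega>. maxsum f n \<omega> \<partial>\<Omega>)"
        by (rule integral_shift) measurable
      moreover have "(\<integral>\<omega>. maxsum f n \<omega> \<partial>\<Omega>) \<le> (\<integral>\<omega>. maxsum f (Suc n) \<omega> \<partial>\<Omega>)"
        by (intro integral_mono integrable_maxsum f maxsum_mono) simp
      ultimately show ?thesis by linarith
    qed
    ultimately have "(\<integral>\<omega>. f \<omega> \<partial>\<Omega>) \<ge> 0"
      by (intro LIMSEQ_le_const) auto
    with neg show False by simp
  qed
  ultimately have "AE \<omega> in \<Omega>. \<omega> \<notin> A"
    by (intro AE_not_in) (simp add: null_sets_def Om.emeasure_eq_measure)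
  then show ?thesis
    by eventually_elim (auto simp: A' not_less)
qed

text \<open>Subtracting the midpoint \<open>c - e\<close> between the mean and \<open>c\<close>
  leaves a function of negative mean, whose sums are bounded above; after division by
  \<open>n\<close> the bound falls below the remaining gap \<open>e\<close>.\<close>

lemma ergodic_average_upper:
  assumes f: "integrable \<Omega> f" and "c > (\<integral>\<omega>. f \<omega> \<partial>\<Omega>)"
  shows "AE \<omega> in \<Omega>. \<forall>\<^sub>F n in sequentially. (\<Sum>k<n. f (shift (int k) \<omega>)) / real n < c"
proof -
  define e where "e = (c - (\<integral>\<omega>. f \<omega> \<partial>\<Omega>)) / 2"
  have e: "e > 0" using assms by (simp add: e_def)
  let ?g = "\<lambda>\<omega>. f \<omega> - (c - e)"
  have "integrable \<Omega> ?g" using f by simp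
  moreover have "(\<integral>\<omega>. ?g \<omega> \<partial>\<Omega>) < 0"
    using assms by (simp add: e_def Om.prob_space[simplified] field_simps)
  ultimately have "AE \<omega> in \<Omega>. \<exists>C. \<forall>n. maxsum ?g n \<omega> \<le> C"
    by (rule maxsum_bounded)
  then show ?thesis
  proof eventually_elim
    case (elim \<omega>)
    then obtain C where "\<And>n. maxsum ?g n \<omega> \<le> C" by blast
    then have C: "(\<Sum>k<n. ?g (shift (int k) \<omega>)) \<le> C" for n
      using sum_le_maxsum[of ?g \<omega> n] by (meson order_trans)
    obtain N :: nat where N: "C / e < real N" using reals_Archimedean2 by blast
    show ?case unfolding eventually_sequentially
    proof (intro exI allI impI)
      fix n assume n: "Suc N \<le> n"
      have "(\<Sum>k<n. f (shift (int k) \<omega>)) \<le> C + real n * (c - e)"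
        using C[of n] by (simp add: sum_subtractf)
      moreover have "C < e * real n"
        using N n e by (simp add: field_simps) (smt (verit) mult_left_mono of_nat_mono of_nat_Suc)
      ultimately show "(\<Sum>k<n. f (shift (int k) \<omega>)) / real n < c"
        using n by (simp add: field_simps)
    qed
  qed
qed

theorem ergodic_average:
  assumes f: "integrable \<Omega> f"
  shows "AE \<omega> in \<Omega>. (\<lambda>n. (\<Sum>k<n. f (shift (int k) \<omega>)) / real n) \<longlonglongrightarrow> (\<integral>\<omega>. f \<omega> \<partial>\<Omega>)"
proof -
  let ?E = "\<integral>\<omega>. f \<omega> \<partial>\<Omega>" and ?a = "\<lambda>\<omega> n. (\<Sum>k<n. f (shift (int k) \<omega>)) / real n"
  have up: "AE \<omega> in \<Omega>. \<forall>j::nat. \<forall>\<^sub>F n in sequentially. ?a \<omega> n < ?E + 1 / Suc j"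
    unfolding AE_all_countable by (intro allI ergodic_average_upper f) simp
  have "AE \<omega> in \<Omega>. \<forall>j::nat. \<forall>\<^sub>F n in sequentially.
      (\<Sum>k<n. - f (shift (int k) \<omega>)) / real n < (\<integral>\<omega>. - f \<omega> \<partial>\<Omega>) + 1 / Suc j"
    unfolding AE_all_countable by (intro allI ergodic_average_upper) (use f in simp_all)
  then have lo: "AE \<omega> in \<Omega>. \<forall>j::nat. \<forall>\<^sub>F n in sequentially. ?E - 1 / Suc j < ?a \<omega> n"
  proof eventually_elim
    case (elim \<omega>)
    show ?case
    proof
      fix j
      from elim[rule_format, of j]
      show "\<forall>\<^sub>F n in sequentially. ?E - 1 / Suc j < ?a \<omega> n"
        by eventually_elim (simp add: sum_negf)
    qed
  qed
  from up lo show ?thesis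
  proof eventually_elim
    case (elim \<omega>)
    show ?case
    proof (rule tendstoI)
      fix e :: real assume "e > 0"
      then obtain j where j: "1 / real (Suc j) < e"
        using nat_approx_posE by blast
      from elim(1)[rule_format, of j] elim(2)[rule_format, of j]
      show "\<forall>\<^sub>F n in sequentially. dist (?a \<omega> n) ?E < e"
        by eventually_elim (use j in \<open>simp add: dist_real_def\<close>)
    qed
  qed
qed

end

section \<open>Events detected with conditional probability bounded below\<close>

text \<open>Given the past up to the first time \<^term>\<open>n \<ge> m\<close> at which \<^term>\<open>C n\<close> occurs, \<^term>\<open>D n\<close> still
  has conditional probability at least \<^term>\<open>c\<close>.\<close>
lemma (in prob_space) eventually_not_of_first_hit:
  assumes C [measurable]: "\<And>n::nat. C n \<in> events" and D [measurable]: "\<And>n. D n \<in> events" and c: "c > 0"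
    and hit: "\<And>m n. m \<le> n \<Longrightarrow>
      c * prob (C n - (\<Union>j\<in>{m..<n}. C j)) \<le> prob ((C n - (\<Union>j\<in>{m..<n}. C j)) \<inter> D n)"
    and CD: "AE \<omega> in M. \<forall>\<^sub>F n in sequentially. \<not> (\<omega> \<in> C n \<and> \<omega> \<in> D n)"
  shows "AE \<omega> in M. \<forall>\<^sub>F n in sequentially. \<omega> \<notin> C n"
proof -
  define F where "F m n = C n - (\<Union>j\<in>{m..<n}. C j)" for m n
  have F [measurable]: "F m n \<in> events" for m n unfolding F_def by measurable
  define H where "H m = (\<Union>n\<in>{m..}. C n \<inter> D n)" for m
  have H [measurable]: "H m \<in> events" for m unfolding H_def by measurable
  define U where "U m = (\<Union>n\<in>{m..}. C n)" for m
  have U [measurable]: "U m \<in> events" for m unfolding U_def by measurable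
  have dF: "disjoint_family (\<lambda>n. F m (m + n))" for m
    unfolding disjoint_family_on_def
  proof (intro ballI impI)
    fix a b :: nat assume "a \<noteq> b"
    then show "F m (m + a) \<inter> F m (m + b) = {}"
      by (cases a b rule: linorder_cases) (auto simp: F_def)
  qed
  have UF: "U m = (\<Union>n. F m (m + n))" for m
  proof (intro set_eqI iffI)
    fix \<omega> assume "\<omega> \<in> U m"
    then have ex: "\<exists>n. \<omega> \<in> C (m + n)" unfolding U_def using le_Suc_ex by auto
    define n where "n = (LEAST n. \<omega> \<in> C (m + n))"
    have "\<omega> \<in> C (m + n)" unfolding n_def by (rule LeastI_ex[OF ex])
    moreover have "\<omega> \<notin> C j" if "m \<le> j" "j < m + n" for j
      using not_less_Least[of "j - m" "\<lambda>n. \<omega> \<in> C (m + n)"] that by (auto simp: n_def)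
    ultimately show "\<omega> \<in> (\<Union>n. F m (m + n))" by (auto simp: F_def)
  qed (auto simp: U_def F_def)
  \<comment> \<open>Decomposing \<open>U m\<close> by the time of the first hit gives disjoint
    pieces, over which the bounds \<open>hit\<close> add up. The events \<open>H m\<close> decrease
    to a null set by \<open>CD\<close>.\<close>
  have UH: "c * prob (U m) \<le> prob (H m)" for m
  proof -
    have "(\<lambda>n. prob (F m (m + n))) sums prob (U m)"
      unfolding UF by (rule finite_measure_UNION[OF _ dF]) auto
    then have s1: "(\<lambda>n. c * prob (F m (m + n))) sums (c * prob (U m))" by (rule sums_mult)
    have s2: "(\<lambda>n. prob (F m (m + n) \<inter> D (m + n))) sums prob (\<Union>n. F m (m + n) \<inter> D (m + n))"
      using dF[of m] by (intro finite_measure_UNION) (auto simp: disjoint_family_on_def)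
    have "c * prob (U m) \<le> prob (\<Union>n. F m (m + n) \<inter> D (m + n))"
      using hit by (intro sums_le[OF _ s1 s2]) (simp add: F_def)
    also have "\<dots> \<le> prob (H m)"
      by (intro finite_measure_mono) (auto simp: H_def F_def)
    finally show ?thesis .
  qed
  have "(\<lambda>m. prob (H m)) \<longlonglongrightarrow> prob (\<Inter>m. H m)"
  proof (rule finite_Lim_measure_decseq)
    show "decseq H" unfolding decseq_def H_def by (intro allI impI UN_mono) auto
  qed auto
  moreover have "prob (\<Inter>m. H m) = 0"
  proof -
    have "AE \<omega> in M. \<omega> \<notin> (\<Inter>m. H m)"
      using CD
    proof eventually_elim
      case (elim \<omega>)
      then obtain N where "\<And>n. n \<ge> N \<Longrightarrow> \<not> (\<omega> \<in> C n \<and> \<omega> \<in> D n)"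
        by (auto simp: eventually_sequentially)
      then have "\<omega> \<notin> H N" by (auto simp: H_def)
      then show ?case by blast
    qed
    then show ?thesis by (subst prob_eq_0) auto
  qed
  ultimately have H0: "(\<lambda>m. prob (H m)) \<longlonglongrightarrow> 0" by simp
  have "prob (\<Inter>m. U m) \<le> prob (H m) / c" for m
  proof -
    have "prob (\<Inter>m. U m) \<le> prob (U m)" by (intro finite_measure_mono) auto
    then show ?thesis using UH[of m] c by (simp add: field_simps) (smt (verit) mult_left_mono)
  qed
  moreover have "(\<lambda>m. prob (H m) / c) \<longlonglongrightarrow> 0" using tendsto_divide_zero[OF H0] .
  ultimately have "prob (\<Inter>m. U m) \<le> 0"
    by (intro LIMSEQ_le_const[of "\<lambda>m. prob (H m) / c"]) auto
  then have "prob (\<Inter>m. U m) = 0" using measure_nonneg[of M "\<Inter>m. U m"] by linarith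
  then have "AE \<omega> in M. \<omega> \<notin> (\<Inter>m. U m)" by (subst (asm) prob_eq_0) auto
  then show ?thesis
    by eventually_elim (auto simp: U_def eventually_sequentially)
qed

section \<open>Limit directions of matrix sequences\<close>

text \<open>\<open>norm\<close> of a matrix is the Frobenius norm, the Euclidean norm of the norms
  of its rows; Cauchy-Schwarz is applied to each row.\<close>

lemma norm_matrix_vector_le: "norm (A *v x) \<le> norm A * norm x" for A :: "real^'n^'m"
proof -
  have "norm ((A *v x) $ i) \<le> norm (A $ i) * norm x" for i
  proof -
    have "(A *v x) $ i = inner (A $ i) x"
      by (simp add: matrix_vector_mult_def inner_vec_def)
    then show ?thesis by (simp add: Cauchy_Schwarz_ineq2)
  qed
  then have "norm (A *v x) \<le> L2_set (\<lambda>i. norm (A $ i) * norm x) UNIV"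
    unfolding norm_vec_def[of "A *v x"] by (intro L2_set_mono) auto
  also have "\<dots> = norm A * norm x"
    by (simp add: norm_vec_def[of A] L2_set_left_distrib)
  finally show ?thesis .
qed

lemma norm_transpose: "norm (transpose A) = norm A" for A :: "real^'n^'m"
proof -
  have "(\<Sum>i\<in>UNIV. \<Sum>j\<in>UNIV. (A $ j $ i)\<^sup>2) = (\<Sum>j\<in>UNIV. \<Sum>i\<in>UNIV. (A $ j $ i)\<^sup>2)"
    by (rule sum.swap)
  then have "inner (transpose A) (transpose A) = inner A A"
    by (simp add: inner_vec_def transpose_def power2_eq_square)
  then show ?thesis by (simp add: norm_eq_sqrt_inner)
qed

lemma norm_matrix_matrix_le: "norm (A ** B) \<le> norm A * norm B"
  for A :: "real^'n^'m" and B :: "real^'k^'n"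
proof -
  have "norm ((A ** B) $ i) \<le> norm (A $ i) * norm B" for i
  proof -
    have "(A ** B) $ i = transpose B *v (A $ i)"
      by (simp add: vec_eq_iff matrix_matrix_mult_def matrix_vector_mult_def transpose_def mult.commute)
    then show ?thesis
      using norm_matrix_vector_le[of "transpose B" "A $ i"] by (simp add: norm_transpose mult.commute)
  qed
  then have "norm (A ** B) \<le> L2_set (\<lambda>i. norm (A $ i) * norm B) UNIV"
    unfolding norm_vec_def[of "A ** B"] by (intro L2_set_mono) auto
  also have "\<dots> = norm A * norm B"
    by (simp add: norm_vec_def[of A] L2_set_left_distrib)
  finally show ?thesis .
qed

lemma inner_matrix_transpose: "inner v (A *v w) = inner (transpose A *v v) w" for A :: "real^'n^'m"
  by (simp add: dot_lmul_matrix)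

text \<open>The part of \<open>b\<close> orthogonal to \<open>a\<close> is by hypothesis orthogonal
  to \<open>b\<close> too, and so vanishes.\<close>

lemma parallel_if_orthogonal_subset:
  fixes a b :: "'v::real_inner"
  assumes "a \<noteq> 0" "b \<noteq> 0" and "\<And>w. inner a w = 0 \<Longrightarrow> inner b w = 0"
  obtains c where "c \<noteq> 0" "b = c *\<^sub>R a"
proof
  let ?c = "inner a b / inner a a"
  define w where "w = b - ?c *\<^sub>R a"
  have aw: "inner a w = 0" using assms(1) by (simp add: w_def inner_diff_right)
  have "inner w w = inner b w - ?c * inner a w" by (simp add: w_def inner_diff_left)
  then have "w = 0" using aw assms(3)[OF aw] by simp
  then show b: "b = ?c *\<^sub>R a" by (simp add: w_def)
  then show "?c \<noteq> 0" using assms(2) by auto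
qed

lemma not_tendsto_subseq:
  fixes X :: "nat \<Rightarrow> 'b::metric_space"
  assumes "\<not> X \<longlonglongrightarrow> l"
  shows "\<exists>e>0. \<exists>r. strict_mono r \<and> (\<forall>n::nat. dist (X (r n)) l \<ge> e)"
proof -
  obtain e where e: "e > 0" "\<And>N. \<exists>n\<ge>N. dist (X n) l \<ge> e"
    using assms unfolding lim_sequentially by (auto simp: not_less)
  have "infinite {n. dist (X n) l \<ge> e}"
    using e(2) by (auto simp: infinite_nat_iff_unbounded_le)
  then obtain r :: "nat \<Rightarrow> nat" where "strict_mono r" "\<And>n. r n \<in> {n. dist (X n) l \<ge> e}"
    using infinite_enumerate by blast
  then show ?thesis using e(1) by auto
qed

text \<open>A rank one limit of \<open>M n / norm (M n)\<close> whose kernel is the orthogonal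
  complement of \<open>v\<close> has Frobenius norm 1, so it maps \<open>w\<close> to a vector of
  norm \<open>\<bar>inner v w\<bar> / norm v\<close>. Recording these norms replaces subsequential
  limits by one convergent real sequence for each \<open>w\<close>; it ignores the range of the
  limits and the choice of a multiple of \<open>v\<close>.\<close>

definition direction_of :: "(nat \<Rightarrow> real^'d^'d) \<Rightarrow> real^'d \<Rightarrow> bool" where
  "direction_of M v \<longleftrightarrow> v \<noteq> 0 \<and>
     (\<forall>w. (\<lambda>n. norm (M n *v w) / norm (M n)) \<longlonglongrightarrow> \<bar>inner v w\<bar> / norm v)"

text \<open>Such an L has the form v u^T with Frobenius norm |v| |u|, so |u| = 1 / |v|, and its
  transpose sends \<open>w\<close> to <v, w> u.\<close>

lemma rank_one_range_transpose:
  fixes L :: "real^'d^'d"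
  assumes v: "v \<noteq> 0" and r: "range (\<lambda>x. L *v x) = span {v}" and "norm L = 1"
  shows "norm (transpose L *v w) = \<bar>inner v w\<bar> / norm v"
proof -
  define u where "u = (1 / inner v v) *\<^sub>R (transpose L *v v)"
  have L: "L *v x = inner u x *\<^sub>R v" for x
  proof -
    have "L *v x \<in> span {v}" using r by auto
    then obtain c where c: "L *v x = c *\<^sub>R v" by (auto simp: span_singleton)
    have "inner (transpose L *v v) x = c * inner v v"
      using inner_matrix_transpose[of v L x] c by simp
    then have "c = inner u x" using v by (simp add: u_def)
    with c show ?thesis by simp
  qed
  have Li: "L $ i = v $ i *\<^sub>R u" for i
  proof -
    have "L $ i $ j = (L *v axis j 1) $ i" for j
      by (simp add: matrix_vector_mult_basis column_def)
    then show ?thesis by (simp add: vec_eq_iff L inner_axis mult.commute)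
  qed
  have "norm L = L2_set (\<lambda>i. norm (v $ i) * norm u) UNIV"
    unfolding norm_vec_def[of L] Li by simp
  also have "\<dots> = norm v * norm u" by (simp add: norm_vec_def[of v] L2_set_left_distrib)
  finally have nu: "norm u = 1 / norm v" using assms(3) v by (simp add: field_simps)
  have "inner (transpose L *v w - inner v w *\<^sub>R u) x = 0" for x
    using inner_matrix_transpose[of w L x] L[of x]
    by (simp add: inner_diff_left inner_diff_right inner_commute mult.commute)
  then have "transpose L *v w = inner v w *\<^sub>R u"
    using inner_eq_zero_iff[of "transpose L *v w - inner v w *\<^sub>R u"] by simp
  then show ?thesis by (simp add: nu)
qed

text \<open>A subsequence violating the limit would, by compactness of the Frobenius unit sphere,
  have a further subsequence along which the normalised matrices converge; their limit is a limit
  point, where the value is known.\<close>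

lemma direction_of_limits_rank_one:
  fixes M :: "nat \<Rightarrow> real^'d^'d"
  assumes nz: "\<And>n. M n \<noteq> 0" and v: "v \<noteq> 0"
    and lim: "limits_rank_one_onto (\<lambda>n. (1 / norm (M n)) *\<^sub>R M n) v"
  shows "direction_of (\<lambda>n. transpose (M n)) v"
proof -
  have "(\<lambda>n. norm (transpose (M n) *v w) / norm (M n)) \<longlonglongrightarrow> \<bar>inner v w\<bar> / norm v" (is "?X \<longlonglongrightarrow> ?l") for w
  proof (rule ccontr)
    assume "\<not> ?X \<longlonglongrightarrow> ?l"
    from not_tendsto_subseq[OF this]
    obtain e and r :: "nat \<Rightarrow> nat" where e: "e > 0" and r: "strict_mono r" "\<And>n. dist (?X (r n)) ?l \<ge> e"
      by auto
    define Y where "Y = (\<lambda>n. (1 / norm (M n)) *\<^sub>R M n)"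
    have nY: "norm (Y n) = 1" for n using nz by (simp add: Y_def)
    have "compact (sphere (0 :: real^'d^'d) 1)" by simp
    then have "\<exists>L\<in>sphere 0 1. \<exists>s. strict_mono s \<and> ((Y \<circ> r) \<circ> s) \<longlonglongrightarrow> L"
      unfolding compact_def by (elim allE[of _ "Y \<circ> r"]) (simp add: nY)
    then obtain L s where s: "strict_mono s" "((Y \<circ> r) \<circ> s) \<longlonglongrightarrow> L" and L: "L \<in> sphere 0 1"
      by blast
    have lp: "limit_point Y L"
      unfolding limit_point_def
    proof (intro exI[of _ "r \<circ> s"] conjI)
      show "strict_mono (r \<circ> s)" using r(1) s(1) by (rule strict_mono_o)
      show "(Y \<circ> (r \<circ> s)) \<longlonglongrightarrow> L" using s(2) by (simp add: comp_assoc)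
    qed
    then have "range (\<lambda>x. L *v x) = span {v}"
      using lim by (simp add: limits_rank_one_onto_def Y_def)
    then have nL: "norm (transpose L *v w) = ?l"
      using v L by (intro rank_one_range_transpose) auto
    have Yt: "norm (transpose (Y n) *v w) = ?X n" for n
    proof -
      have "transpose (Y n) *v w = (1 / norm (M n)) *\<^sub>R (transpose (M n) *v w)"
        by (simp add: Y_def transpose_scalar scaleR_matrix_vector_assoc del: transpose_matrix_vector)
      then show ?thesis by simp
    qed
    have "linear (\<lambda>A :: real^'d^'d. transpose A *v w)"
    proof (rule linearI)
      fix A B :: "real^'d^'d" and c :: real
      have "transpose (A + B) = transpose A + transpose B"
        by (simp add: vec_eq_iff transpose_def)
      then show "transpose (A + B) *v w = transpose A *v w + transpose B *v w"
        by (simp add: matrix_vector_mult_add_rdistrib del: transpose_matrix_vector)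
      show "transpose (c *\<^sub>R A) *v w = c *\<^sub>R (transpose A *v w)"
        by (simp add: transpose_scalar scaleR_matrix_vector_assoc del: transpose_matrix_vector)
    qed
    then have "bounded_linear (\<lambda>A :: real^'d^'d. transpose A *v w)"
      by (simp only: linear_conv_bounded_linear)
    from bounded_linear.tendsto[OF this s(2)]
    have "(\<lambda>n. norm (transpose (Y (r (s n))) *v w)) \<longlonglongrightarrow> norm (transpose L *v w)"
      by (intro tendsto_norm) (simp add: o_def)
    then have "(\<lambda>n. ?X (r (s n))) \<longlonglongrightarrow> ?l" by (simp only: Yt nL)
    from tendstoD[OF this e] obtain n where "dist (?X (r (s n))) ?l < e"
      unfolding eventually_sequentially by blast
    with r(2)[of "s n"] show False by simp
  qed
  then show ?thesis using v by (simp add: direction_of_def norm_transpose)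
qed

lemma direction_of_transpose_limits_rank_one:
  fixes M :: "nat \<Rightarrow> real^'d^'d"
  assumes nz: "\<And>n. M n \<noteq> 0" and v: "v \<noteq> 0"
    and lim: "limits_rank_one_onto (\<lambda>n. (1 / norm (M n)) *\<^sub>R transpose (M n)) v"
  shows "direction_of M v"
proof -
  have "transpose (M n) \<noteq> 0" for n
    using nz[of n] norm_transpose[of "M n"] by auto
  from direction_of_limits_rank_one[OF this v] lim show ?thesis
    by (simp add: norm_transpose)
qed

text \<open>If \<open>direction_of M v\<close> holds, this is the orthogonal complement of
  \<open>v\<close>; it refers to \<open>M\<close> alone and is a subspace for every
  \<open>M\<close>.\<close>

definition null_directions :: "(nat \<Rightarrow> real^'d^'d) \<Rightarrow> (real^'d) set" where
  "null_directions M = {w. (\<lambda>n. norm (M n *v w) / norm (M n)) \<longlonglongrightarrow> 0}"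

lemma subspace_null_directions: "subspace (null_directions M)"
proof (rule subspaceI)
  show "0 \<in> null_directions M" by (simp add: null_directions_def)
next
  fix v w assume "v \<in> null_directions M" "w \<in> null_directions M"
  then have "(\<lambda>n. norm (M n *v v) / norm (M n) + norm (M n *v w) / norm (M n)) \<longlonglongrightarrow> 0"
    using tendsto_add[of _ 0 _ _ 0] by (simp add: null_directions_def)
  then have "(\<lambda>n. norm (M n *v (v + w)) / norm (M n)) \<longlonglongrightarrow> 0"
    by (rule tendsto_0_le[where K=1])
      (auto simp: matrix_vector_right_distrib add_divide_distrib[symmetric]
        intro!: divide_right_mono norm_triangle_ineq eventuallyI)
  then show "v + w \<in> null_directions M" by (simp add: null_directions_def)
next
  fix c v assume "v \<in> null_directions M"
  then have "(\<lambda>n. \<bar>c\<bar> * (norm (M n *v v) / norm (M n))) \<longlonglongrightarrow> 0"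
    by (intro tendsto_mult_right_zero) (simp add: null_directions_def)
  then show "c *\<^sub>R v \<in> null_directions M"
    by (simp add: null_directions_def matrix_vector_mult_scaleR)
qed

lemma null_directions_direction_of:
  assumes "direction_of M v"
  shows "w \<in> null_directions M \<longleftrightarrow> inner v w = 0"
proof -
  have lim: "(\<lambda>n. norm (M n *v w) / norm (M n)) \<longlonglongrightarrow> \<bar>inner v w\<bar> / norm v" and v: "v \<noteq> 0"
    using assms by (auto simp: direction_of_def)
  show ?thesis
  proof
    assume "w \<in> null_directions M"
    with lim have "\<bar>inner v w\<bar> / norm v = 0"
      by (intro LIMSEQ_unique) (auto simp: null_directions_def)
    then show "inner v w = 0" using v by simp
  qed (use lim in \<open>simp add: null_directions_def\<close>)
qed

text \<open>The vectors in the numerators agree, and the norms in the denominators differ by factors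
  bounded by \<open>norm A\<close> and \<open>norm A'\<close>, where \<open>A'\<close> is the
  inverse; this does not affect convergence to 0.\<close>

lemma null_directions_step:
  fixes M N :: "nat \<Rightarrow> real^'d^'d"
  assumes A: "invertible A" and N: "\<And>n. N (Suc n) = M n ** A"
  shows "w \<in> null_directions N \<longleftrightarrow> A *v w \<in> null_directions M"
proof -
  obtain A' where A': "A ** A' = mat 1" using A by (auto simp: invertible_def)
  have M: "M n = N (Suc n) ** A'" for n
    by (simp add: N matrix_mul_assoc[symmetric] A')
  have Nw: "N (Suc n) *v w = M n *v (A *v w)" for n by (simp add: N matrix_vector_mul_assoc)
  have 1: "norm (N (Suc n) *v w) / norm (N (Suc n)) \<le> norm (M n *v (A *v w)) / norm (M n) * norm A'" for n
  proof (cases "M n = 0")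
    case False
    then have "norm (N (Suc n)) > 0" "norm (M n) > 0" using M[of n] by auto
    moreover have "norm (M n) \<le> norm (N (Suc n)) * norm A'"
      by (subst M) (rule norm_matrix_matrix_le)
    then have "norm (M n *v (A *v w)) * norm (M n) \<le> norm (M n *v (A *v w)) * (norm (N (Suc n)) * norm A')"
      by (rule mult_left_mono) simp
    ultimately show ?thesis unfolding Nw by (simp add: field_simps)
  qed (simp add: N)
  have 2: "norm (M n *v (A *v w)) / norm (M n) \<le> norm (N (Suc n) *v w) / norm (N (Suc n)) * norm A" for n
  proof (cases "M n = 0")
    case False
    then have "norm (N (Suc n)) > 0" "norm (M n) > 0" using M[of n] by auto
    moreover have "norm (N (Suc n)) \<le> norm (M n) * norm A"
      by (subst N) (rule norm_matrix_matrix_le)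
    then have "norm (M n *v (A *v w)) * norm (N (Suc n)) \<le> norm (M n *v (A *v w)) * (norm (M n) * norm A)"
      by (rule mult_left_mono) simp
    ultimately show ?thesis unfolding Nw by (simp add: field_simps)
  qed simp
  have "w \<in> null_directions N \<longleftrightarrow> (\<lambda>n. norm (N (Suc n) *v w) / norm (N (Suc n))) \<longlonglongrightarrow> 0"
    unfolding null_directions_def mem_Collect_eq
    by (rule filterlim_sequentially_Suc[symmetric])
  also have "\<dots> \<longleftrightarrow> (\<lambda>n. norm (M n *v (A *v w)) / norm (M n)) \<longlonglongrightarrow> 0"
  proof
    assume "(\<lambda>n. norm (N (Suc n) *v w) / norm (N (Suc n))) \<longlonglongrightarrow> 0"
    then show "(\<lambda>n. norm (M n *v (A *v w)) / norm (M n)) \<longlonglongrightarrow> 0"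
      by (rule tendsto_0_le[where K="norm A"]) (use 2 in \<open>auto intro!: eventuallyI\<close>)
  next
    assume "(\<lambda>n. norm (M n *v (A *v w)) / norm (M n)) \<longlonglongrightarrow> 0"
    then show "(\<lambda>n. norm (N (Suc n) *v w) / norm (N (Suc n))) \<longlonglongrightarrow> 0"
      by (rule tendsto_0_le[where K="norm A'"]) (use 1 in \<open>auto intro!: eventuallyI\<close>)
  qed
  finally show ?thesis by (simp add: null_directions_def)
qed

lemma direction_of_unique:
  assumes "direction_of M v" "direction_of M v'"
  obtains c where "c \<noteq> 0" "v' = c *\<^sub>R v"
proof -
  have nz: "v \<noteq> 0" "v' \<noteq> 0" using assms by (auto simp: direction_of_def)
  have "inner v' w = 0" if "inner v w = 0" for w
    using that null_directions_direction_of[OF assms(1)] null_directions_direction_of[OF assms(2)]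
    by blast
  from parallel_if_orthogonal_subset[OF nz this] that show thesis by blast
qed

lemma invertible_mult_eq_0_iff:
  fixes A :: "real^'n^'n"
  assumes "invertible A"
  shows "A *v x = 0 \<longleftrightarrow> x = 0"
proof
  obtain A' where "A' ** A = mat 1" using assms by (auto simp: invertible_def)
  then have "x = A' *v (A *v x)" by (simp add: matrix_vector_mul_assoc)
  then show "A *v x = 0 \<Longrightarrow> x = 0" by simp
qed simp

lemma invertible_transpose: "invertible A \<Longrightarrow> invertible (transpose A)" for A :: "real^'n^'n"
proof -
  assume "invertible A"
  then obtain B where "A ** B = mat 1" "B ** A = mat 1" by (auto simp: invertible_def)
  then have "transpose B ** transpose A = mat 1" "transpose A ** transpose B = mat 1"
    by (simp_all flip: matrix_transpose_mul)
  then show ?thesis unfolding invertible_def by blast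
qed

text \<open>Equivariance of directions: the orthogonal complement of \<open>v\<close> is the
  preimage under \<open>A\<close> of that of \<open>v'\<close>, which is the complement of
  \<open>transpose A *v v'\<close>.\<close>

lemma direction_of_step:
  fixes M N :: "nat \<Rightarrow> real^'d^'d"
  assumes A: "invertible A" and N: "\<And>n. N (Suc n) = M n ** A"
    and v: "direction_of N v" and v': "direction_of M v'"
  obtains c where "c \<noteq> 0" "v = c *\<^sub>R (transpose A *v v')"
proof -
  have nz: "v \<noteq> 0" "v' \<noteq> 0" using v v' by (auto simp: direction_of_def)
  then have nz': "transpose A *v v' \<noteq> 0"
    using A by (metis invertible_mult_eq_0_iff invertible_transpose)
  have orth: "inner v w = 0" if "inner (transpose A *v v') w = 0" for w
    using that null_directions_step[where M=M and N=N and A=A and w=w, OF A N]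
    by (simp add: null_directions_direction_of[OF v] null_directions_direction_of[OF v'] inner_matrix_transpose del: transpose_matrix_vector)
  from parallel_if_orthogonal_subset[OF nz' nz(1) orth] that show thesis by blast
qed

section \<open>The cocycle of products and the telescoping of increments\<close>

lemma Amat_Suc_shift: "Amat (Suc n) (shift 1 \<omega>) = Amat (Suc (Suc n)) \<omega>"
  by (simp add: Amat_def shift_def algebra_simps)

lemma Amat_Suc: "Amat (Suc n) \<omega> = Amat 1 (shift (int n) \<omega>)"
  by (simp add: Amat_def shift_def)

lemma Bmat_Suc: "Bmat (Suc n) \<omega> = Bmat 1 (shift (int n) \<omega>)"
  by (simp add: Bmat_def shift_def)

lemma Sprod_Suc_shift: "Sprod (Suc n) \<omega> = Sprod n (shift 1 \<omega>) ** Amat 1 \<omega>"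
proof (induction n)
  case (Suc n)
  have "Sprod (Suc (Suc n)) \<omega> = Amat (Suc (Suc n)) \<omega> ** Sprod (Suc n) \<omega>"
    by (rule Sprod.simps)
  also have "\<dots> = Amat (Suc n) (shift 1 \<omega>) ** (Sprod n (shift 1 \<omega>) ** Amat 1 \<omega>)"
    by (simp only: Suc.IH Amat_Suc_shift)
  also have "\<dots> = Sprod (Suc n) (shift 1 \<omega>) ** Amat 1 \<omega>"
    by (simp add: matrix_mul_assoc)
  finally show ?case .
qed simp

text \<open>The product of the matrices at the coordinates -n, ..., -1 with the newest on the left,
  so increasing \<open>n\<close> multiplies by an older matrix on the right.\<close>

definition Sback :: "nat \<Rightarrow> (int \<Rightarrow> ('d::finite) mat \<times> 'd mat) \<Rightarrow> 'd mat" where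
  "Sback n \<omega> = Sprod n (shift (- int n) \<omega>)"

lemma Sback_Suc_shift: "Sback (Suc n) (shift 1 \<omega>) = Amat 1 \<omega> ** Sback n \<omega>"
  by (simp add: Sback_def shift_shift Amat_Suc[of n])

lemma Sprod_cong:
  assumes "\<And>i. 0 \<le> i \<Longrightarrow> i < int n \<Longrightarrow> \<omega> i = \<omega>' i"
  shows "Sprod n \<omega> = Sprod n \<omega>'"
  using assms by (induction n) (auto simp: Amat_def)

lemma Tsum_cong:
  assumes "\<And>i. 0 \<le> i \<Longrightarrow> i < int n \<Longrightarrow> \<omega> i = \<omega>' i"
  shows "Tsum n \<omega> = Tsum n \<omega>'"
  using assms
proof (induction n)
  case (Suc n)
  then show ?case using Sprod_cong[of n \<omega> \<omega>'] by (auto simp: Amat_def Bmat_def)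
qed simp

lemma Sback_cong:
  assumes "\<And>i. i < 0 \<Longrightarrow> \<omega> i = \<omega>' i"
  shows "Sback n \<omega> = Sback n \<omega>'"
  unfolding Sback_def by (rule Sprod_cong) (use assms in \<open>auto simp: shift_def\<close>)

lemma invertible_Sprod:
  assumes "\<And>k. invertible (Amat 1 (shift k \<omega>))"
  shows "invertible (Sprod n \<omega>)"
proof (induction n)
  case 0
  then show ?case unfolding invertible_def by (intro exI[of _ "mat 1"]) simp
next
  case (Suc n)
  then show ?case using assms by (simp only: Sprod.simps Amat_Suc invertible_mult)
qed

lemma invertible_Sback:
  assumes "\<And>k. invertible (Amat 1 (shift k \<omega>))"
  shows "invertible (Sback n \<omega>)"
  unfolding Sback_def by (rule invertible_Sprod) (simp only: shift_shift assms)

lemma invertible_imp_nonzero: "invertible A \<Longrightarrow> A \<noteq> 0" for A :: "real^'n^'n"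
proof
  assume "invertible A" "A = 0"
  then have "axis i (1 :: real) = (0 :: real^'n)" for i
    using invertible_mult_eq_0_iff[of A "axis i 1"] by simp
  then show False by (simp add: axis_eq_0_iff)
qed

text \<open>The one-step relation is iterated. That the scalar does not depend on \<open>v\<close>
  later makes the normalised quotient linear in \<open>v\<close>.\<close>

lemma covector_pullback:
  fixes \<omega> :: "int \<Rightarrow> ('d::finite) mat \<times> 'd mat"
  assumes "\<And>n. \<exists>c. c \<noteq> 0 \<and> \<zeta> n = c *\<^sub>R (transpose (Amat (Suc n) \<omega>) *v \<zeta> (Suc n))"
  shows "\<exists>a. a \<noteq> 0 \<and> (\<forall>v. inner (\<zeta> 0) v = a * inner (\<zeta> n) (Sprod n \<omega> *v v))"
proof (induction n)
  case 0
  then show ?case by (intro exI[of _ 1]) simp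
next
  case (Suc n)
  then obtain a where a: "a \<noteq> 0" "\<And>v. inner (\<zeta> 0) v = a * inner (\<zeta> n) (Sprod n \<omega> *v v)" by blast
  obtain c where c: "c \<noteq> 0" "\<zeta> n = c *\<^sub>R (transpose (Amat (Suc n) \<omega>) *v \<zeta> (Suc n))"
    using assms by blast
  have "inner (\<zeta> 0) v = (a * c) * inner (\<zeta> (Suc n)) (Sprod (Suc n) \<omega> *v v)" for v
    by (simp add: a(2) c(2) inner_matrix_transpose[symmetric] matrix_vector_mul_assoc del: transpose_matrix_vector)
  with a(1) c(1) show ?case by (intro exI[of _ "a * c"]) auto
qed

text \<open>Vanishing denominators do no harm: if one of them is zero, then all of them are.\<close>
lemma sum_increments:
  fixes \<omega> :: "int \<Rightarrow> ('d::finite) mat \<times> 'd mat"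
  assumes "\<And>n. \<exists>c. c \<noteq> 0 \<and> \<zeta> n = c *\<^sub>R (transpose (Amat (Suc n) \<omega>) *v \<zeta> (Suc n))"
    and "\<And>n. \<exists>b. b \<noteq> 0 \<and> y n = b *\<^sub>R (Sprod n \<omega> *v v)"
  shows "(\<Sum>k<n. inner (\<zeta> (Suc k)) (Bmat (Suc k) \<omega> *v y k) / inner (\<zeta> (Suc k)) (Amat (Suc k) \<omega> *v y k))
    = inner (\<zeta> n) (Tsum n \<omega> *v v) / inner (\<zeta> n) (Sprod n \<omega> *v v)"
proof (induction n)
  case (Suc n)
  obtain c where c: "c \<noteq> 0" "\<zeta> n = c *\<^sub>R (transpose (Amat (Suc n) \<omega>) *v \<zeta> (Suc n))"
    using assms(1) by blast
  obtain b where b: "b \<noteq> 0" "y n = b *\<^sub>R (Sprod n \<omega> *v v)" using assms(2) by blast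
  \<comment> \<open>Up to the nonzero factors \<open>b\<close> and \<open>c\<close>, the old
    quotient and the new increment have the same denominator, formed with
    \<open>Sprod (Suc n) \<omega>\<close>; their numerators add up by the recursion for
    \<open>Tsum\<close>.\<close>
  have 1: "inner (\<zeta> n) (X *v v) = c * inner (\<zeta> (Suc n)) ((Amat (Suc n) \<omega> ** X) *v v)" for X
    by (simp add: c(2) inner_matrix_transpose[symmetric] matrix_vector_mul_assoc del: transpose_matrix_vector)
  have 2: "inner (\<zeta> (Suc n)) (X *v y n) = b * inner (\<zeta> (Suc n)) ((X ** Sprod n \<omega>) *v v)" for X
    by (simp add: b(2) matrix_vector_mult_scaleR matrix_vector_mul_assoc)
  show ?case using b(1) c(1)
    by (simp add: Suc 1 2 matrix_vector_mult_add_rdistrib inner_add_right add_divide_distrib)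
qed simp

section \<open>Random matrices\<close>

lemma pred_tendsto_0 [measurable]:
  fixes f :: "nat \<Rightarrow> 'a \<Rightarrow> real"
  assumes [measurable]: "\<And>n. f n \<in> borel_measurable M"
  shows "Measurable.pred M (\<lambda>x. (\<lambda>n. f n x) \<longlonglongrightarrow> 0)"
proof -
  have "(\<lambda>n. f n x) \<longlonglongrightarrow> 0 \<longleftrightarrow> (\<forall>j::nat. \<exists>N. \<forall>n\<ge>N. \<bar>f n x\<bar> < 1 / real (Suc j))" for x
  proof
    assume "(\<lambda>n. f n x) \<longlonglongrightarrow> 0"
    then show "\<forall>j::nat. \<exists>N. \<forall>n\<ge>N. \<bar>f n x\<bar> < 1 / real (Suc j)"
      by (auto simp: lim_sequentially dist_real_def simp del: of_nat_Suc)
  next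
    assume *: "\<forall>j::nat. \<exists>N. \<forall>n\<ge>N. \<bar>f n x\<bar> < 1 / real (Suc j)"
    show "(\<lambda>n. f n x) \<longlonglongrightarrow> 0"
      unfolding lim_sequentially
    proof (intro allI impI)
      fix e :: real assume "e > 0"
      then obtain j where "1 / real (Suc j) < e" using nat_approx_posE by blast
      with * show "\<exists>N. \<forall>n\<ge>N. dist (f n x) 0 < e"
        by (simp add: dist_real_def) (meson less_trans)
    qed
  qed
  then show ?thesis by simp
qed

lemma borel_measurable_matrix_vector_mult [measurable (raw)]:
  fixes f :: "'a \<Rightarrow> real^'n^'m"
  assumes "f \<in> borel_measurable M" "g \<in> borel_measurable M"
  shows "(\<lambda>x. f x *v g x) \<in> borel_measurable M"
  using assms
proof (rule borel_measurable_continuous_Pair)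
  show "continuous_on UNIV (\<lambda>x :: (real^'n^'m) \<times> (real^'n). fst x *v snd x)"
    unfolding matrix_vector_mult_def by (intro continuous_intros)
qed

lemma borel_measurable_matrix_matrix_mult [measurable (raw)]:
  fixes f :: "'a \<Rightarrow> real^'n^'m" and g :: "'a \<Rightarrow> real^'k^'n"
  assumes "f \<in> borel_measurable M" "g \<in> borel_measurable M"
  shows "(\<lambda>x. f x ** g x) \<in> borel_measurable M"
  using assms
proof (rule borel_measurable_continuous_Pair)
  show "continuous_on UNIV (\<lambda>x :: (real^'n^'m) \<times> (real^'k^'n). fst x ** snd x)"
    unfolding matrix_matrix_mult_def by (intro continuous_intros)
qed

lemma invertible_image_subspace:
  fixes A :: "real^'n^'n"
  assumes "invertible A" "subspace W"
  shows "subspace ((*v) A ` W)" "dim ((*v) A ` W) = dim W"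
proof -
  show "subspace ((*v) A ` W)"
    using assms(2) by (intro linear_subspace_image) auto
  have "inj ((*v) A)"
  proof (rule injI)
    fix x y assume "A *v x = A *v y"
    then have "A *v (x - y) = 0" by (simp add: matrix_vector_mult_diff_distrib)
    then show "x = y" using assms(1) by (simp add: invertible_mult_eq_0_iff)
  qed
  then show "dim ((*v) A ` W) = dim W"
    by (intro dim_image_eq) (auto intro: inj_on_subset)
qed

lemma closed_stabilizer:
  fixes U :: "(real^'d) set"
  assumes "closed U"
  shows "closed {A :: real^'d^'d. (*v) A ` U \<subseteq> U}"
proof -
  have "closed ((\<lambda>A :: real^'d^'d. A *v x) -` U)" for x
  proof (rule closed_vimage[OF assms])
    show "continuous_on UNIV (\<lambda>A :: real^'d^'d. A *v x)"
      unfolding matrix_vector_mult_def by (intro continuous_intros)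
  qed
  then have "closed (\<Inter>x\<in>U. (\<lambda>A :: real^'d^'d. A *v x) -` U)" by (rule closed_INT[OF ballI])
  also have "(\<Inter>x\<in>U. (\<lambda>A :: real^'d^'d. A *v x) -` U) = {A. (*v) A ` U \<subseteq> U}" by auto
  finally show ?thesis .
qed

locale random_matrices =
  fixes lam :: "(('d::finite) mat \<times> 'd mat) measure"
  assumes prob: "prob_space lam" and sets_lam: "sets lam = sets borel"
    and AE_invertible: "AE p in lam. invertible (fst p)"
begin

sublocale bernoulli_shift lam
proof (rule bernoulli_shift.intro[OF prob])
  show "space lam = UNIV" using sets_eq_imp_space_eq[OF sets_lam] by simp
qed

lemma component_borel [measurable]:
  "(\<lambda>\<omega>. fst (\<omega> i)) \<in> borel_measurable \<Omega>" "(\<lambda>\<omega>. snd (\<omega> i)) \<in> borel_measurable \<Omega>"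
proof -
  have "(\<lambda>\<omega>. \<omega> i) \<in> borel_measurable \<Omega>"
    using component_measurable[of i] unfolding measurable_cong_sets[OF refl sets_lam] .
  then have *: "(\<lambda>\<omega>. \<omega> i) \<in> measurable \<Omega> (borel \<Otimes>\<^sub>M borel)" by (simp add: borel_prod)
  show "(\<lambda>\<omega>. fst (\<omega> i)) \<in> borel_measurable \<Omega>" "(\<lambda>\<omega>. snd (\<omega> i)) \<in> borel_measurable \<Omega>"
    using measurable_compose[OF * measurable_fst] measurable_compose[OF * measurable_snd] by auto
qed

lemma matrices_measurable [measurable]:
  "Amat n \<in> borel_measurable \<Omega>" "Bmat n \<in> borel_measurable \<Omega>"
  "Sprod n \<in> borel_measurable \<Omega>" "Tsum n \<in> borel_measurable \<Omega>"
proof -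
  show A [measurable]: "Amat n \<in> borel_measurable \<Omega>" for n
    unfolding Amat_def[abs_def] by measurable
  show B [measurable]: "Bmat n \<in> borel_measurable \<Omega>" for n
    unfolding Bmat_def[abs_def] by measurable
  show S [measurable]: "Sprod n \<in> borel_measurable \<Omega>" for n
  proof (induction n)
    case (Suc n)
    then have [measurable]: "Sprod n \<in> borel_measurable \<Omega>" .
    show ?case unfolding Sprod.simps[abs_def] by measurable
  qed (simp add: Sprod.simps[abs_def])
  show "Tsum n \<in> borel_measurable \<Omega>"
  proof (induction n)
    case (Suc n)
    then have [measurable]: "Tsum n \<in> borel_measurable \<Omega>" .
    show ?case unfolding Tsum.simps[abs_def] by measurable
  qed (simp add: Tsum.simps[abs_def])
qed

lemma AE_all_invertible: "AE \<omega> in \<Omega>. \<forall>k. invertible (Amat 1 (shift k \<omega>))"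
proof (rule AE_all_shift)
  show "AE \<omega> in \<Omega>. invertible (Amat 1 \<omega>)"
    using AE_PiM_component[of UNIV "\<lambda>_. lam" 0, OF prob _ AE_invertible] by (simp add: Amat_def)
qed

text \<open>The open complement of \<open>H\<close> is null for the law of A_1, so it misses the
  support; products and limits then stay in \<open>H\<close>.\<close>

lemma semigroup_of_subset:
  assumes H: "closed H" and one: "mat 1 \<in> H" and mult: "\<And>A B. A \<in> H \<Longrightarrow> B \<in> H \<Longrightarrow> A ** B \<in> H"
    and AE_H: "AE \<omega> in \<Omega>. Amat 1 \<omega> \<in> H"
  shows "semigroup_of (lawA lam) \<subseteq> H"
proof -
  have fst_m [measurable]: "fst \<in> borel_measurable lam"
  proof -
    have "fst \<in> measurable (borel \<Otimes>\<^sub>M (borel :: 'd mat measure)) (borel :: 'd mat measure)"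
      by measurable
    then show ?thesis unfolding borel_prod measurable_cong_sets[OF sets_lam refl] .
  qed
  have "emeasure (lawA lam) (- H) = emeasure lam {p. fst p \<notin> H}"
    unfolding lawA_def using H space_lam
    by (subst emeasure_distr) (auto intro!: arg_cong2[where f=emeasure] fst_m)
  also have "\<dots> = emeasure (distr \<Omega> lam (\<lambda>\<omega>. \<omega> 0)) {p. fst p \<notin> H}"
    by (subst distr_PiM_component) (auto intro: prob)
  also have "\<dots> = emeasure \<Omega> {\<omega>. Amat 1 \<omega> \<notin> H}"
  proof (subst emeasure_distr)
    have "fst -` (- H) \<inter> space lam \<in> sets lam"
      using H by (intro measurable_sets[OF fst_m]) auto
    then show "{p. fst p \<notin> H} \<in> sets lam" by (simp add: space_lam vimage_def)
  qed (auto simp: Amat_def intro!: arg_cong2[where f=emeasure])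
  also have "\<dots> = 0"
  proof -
    have [measurable]: "H \<in> sets borel" using H by simp
    have M: "{\<omega> \<in> space \<Omega>. \<not> Amat 1 \<omega> \<in> H} \<in> sets \<Omega>" by measurable
    show ?thesis using AE_iff_measurable[OF M refl] AE_H by simp
  qed
  finally have null: "emeasure (lawA lam) (- H) = 0" .
  have supp: "support_of (lawA lam) \<subseteq> H"
  proof
    fix M assume "M \<in> support_of (lawA lam)"
    then have "open (- H) \<and> M \<in> - H \<longrightarrow> emeasure (lawA lam) (- H) > 0"
      unfolding support_of_def by blast
    with null H show "M \<in> H" by (auto simp: open_Compl)
  qed
  have "foldr (**) Ms (mat 1) \<in> H" if "set Ms \<subseteq> support_of (lawA lam)" for Ms
    using that supp by (induction Ms) (auto intro: one mult)
  then show ?thesis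
    unfolding semigroup_of_def by (intro closure_minimal H) auto
qed

text \<open>The stabilizer of a finite union of subspaces is a closed semigroup, so almost sure
  invariance under A_1 extends to the whole semigroup in the definition of strong
  irreducibility.\<close>

lemma not_invariant_union:
  assumes irred: "strongly_irreducible (lawA lam)"
    and F: "finite F" "F \<noteq> {}" "\<And>V. V \<in> F \<Longrightarrow> subspace V \<and> V \<noteq> {0} \<and> V \<noteq> UNIV"
    and inv: "AE \<omega> in \<Omega>. (*v) (Amat 1 \<omega>) ` \<Union>F \<subseteq> \<Union>F"
  shows False
proof -
  let ?H = "{A :: real^'d^'d. (*v) A ` \<Union>F \<subseteq> \<Union>F}"
  have "closed (\<Union>F)" using F by (intro closed_Union) (auto intro: closed_subspace)
  then have "semigroup_of (lawA lam) \<subseteq> ?H"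
  proof (intro semigroup_of_subset closed_stabilizer)
    fix A B assume AB: "A \<in> ?H" "B \<in> ?H"
    show "A ** B \<in> ?H"
    proof safe
      fix x V assume "x \<in> V" "V \<in> F"
      then have "B *v x \<in> \<Union>F" using AB(2) by blast
      then have "A *v (B *v x) \<in> \<Union>F" using AB(1) by blast
      then show "(A ** B) *v x \<in> \<Union>F" by (simp add: matrix_vector_mul_assoc)
    qed
  qed (use inv in auto)
  then have "\<exists>F. finite F \<and> F \<noteq> {} \<and>
            (\<forall>V\<in>F. subspace V \<and> V \<noteq> {0} \<and> V \<noteq> (UNIV :: (real^'d) set)) \<and>
            (\<forall>M\<in>semigroup_of (lawA lam). (\<lambda>x. M *v x) ` (\<Union>F) \<subseteq> \<Union>F)"
    using F by (intro exI[of _ F]) blast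
  with irred show False unfolding strongly_irreducible_def by blast
qed

section \<open>Kernels of the limits of the future products\<close>

definition Ker :: "(int \<Rightarrow> 'd mat \<times> 'd mat) \<Rightarrow> (real^'d) set" where
  "Ker \<omega> = null_directions (\<lambda>n. Sprod n \<omega>)"

lemma subspace_Ker: "subspace (Ker \<omega>)"
  unfolding Ker_def by (rule subspace_null_directions)

lemma Ker_step: "invertible (Amat 1 \<omega>) \<Longrightarrow> w \<in> Ker \<omega> \<longleftrightarrow> Amat 1 \<omega> *v w \<in> Ker (shift 1 \<omega>)"
  unfolding Ker_def by (rule null_directions_step) (auto simp: Sprod_Suc_shift simp del: Sprod.simps)

text \<open>As \<open>Ker \<omega>\<close> is a subspace, the inclusion can be tested on a finite
  basis of \<open>W\<close>, which leaves finitely many convergence conditions.\<close>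

lemma Ker_subset_measurable [measurable]:
  assumes "subspace W"
  shows "{\<omega>. W \<subseteq> Ker \<omega>} \<in> sets \<Omega>"
proof -
  obtain B where B: "B \<subseteq> W" "independent B" "W \<subseteq> span B" "card B = dim W"
    by (rule basis_exists)
  then have finB: "finite B" by (simp add: independent_imp_finite)
  have "W \<subseteq> Ker \<omega> \<longleftrightarrow> (\<forall>b\<in>B. (\<lambda>n. norm (Sprod n \<omega> *v b) / norm (Sprod n \<omega>)) \<longlonglongrightarrow> 0)" for \<omega>
  proof -
    have "W \<subseteq> Ker \<omega>" if "B \<subseteq> Ker \<omega>"
      using B(3) span_minimal[OF that subspace_Ker] by (rule order_trans)
    then have "W \<subseteq> Ker \<omega> \<longleftrightarrow> B \<subseteq> Ker \<omega>"
      using order_trans[OF B(1)] by blast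
    also have "\<dots> \<longleftrightarrow> (\<forall>b\<in>B. b \<in> Ker \<omega>)" by (rule subset_iff[unfolded Ball_def[symmetric]])
    finally show ?thesis by (simp only: Ker_def null_directions_def mem_Collect_eq)
  qed
  moreover have "{\<omega> \<in> space \<Omega>. \<forall>b\<in>B. (\<lambda>n. norm (Sprod n \<omega> *v b) / norm (Sprod n \<omega>)) \<longlonglongrightarrow> 0} \<in> sets \<Omega>"
  proof (rule sets.sets_Collect_finite_All[OF _ finB])
    fix b
    have "Measurable.pred \<Omega> (\<lambda>\<omega>. (\<lambda>n. norm (Sprod n \<omega> *v b) / norm (Sprod n \<omega>)) \<longlonglongrightarrow> 0)"
      by (rule pred_tendsto_0) measurable
    then show "{\<omega> \<in> space \<Omega>. (\<lambda>n. norm (Sprod n \<omega> *v b) / norm (Sprod n \<omega>)) \<longlonglongrightarrow> 0} \<in> sets \<Omega>"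
      by (simp add: pred_def)
  qed
  ultimately show ?thesis by simp
qed

lemma Ker_cong: "(\<And>i. 0 \<le> i \<Longrightarrow> \<omega> i = \<omega>' i) \<Longrightarrow> Ker \<omega> = Ker \<omega>'"
  using Sprod_cong[of _ \<omega> \<omega>'] by (simp add: Ker_def)

definition pker :: "(real^'d) set \<Rightarrow> real" where
  "pker W = Om.prob {\<omega>. W \<subseteq> Ker \<omega>}"

text \<open>\<open>W\<close> lies in the kernel iff its image under A_1 lies in the kernel of the
  shifted sample, which is independent of A_1. So \<open>pker\<close> is harmonic: its value at
  \<open>W\<close> is the mean of its values at the random image. The witness is a conditional
  probability, whose measurability comes from \<open>integral_mix\<close>.\<close>

lemma pker_average:
  assumes W: "subspace W"
  shows "\<exists>g. g \<in> borel_measurable \<Omega> \<and> (\<forall>\<omega>. 0 \<le> g \<omega> \<and> g \<omega> \<le> 1) \<and> pker W = (\<integral>\<omega>. g \<omega> \<partial>\<Omega>) \<and>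
    (AE \<omega> in \<Omega>. g \<omega> = pker ((*v) (Amat 1 \<omega>) ` W))"
proof (intro exI conjI)
  \<comment> \<open>Index 0 carries A_1, so the coordinates up to 0 are fixed and the shifted sample
    stays free.\<close>
  define g where "g \<omega> = Om.prob {\<omega>'. mix {..0} \<omega> \<omega>' \<in> {\<omega>. W \<subseteq> Ker \<omega>}}" for \<omega>
  show "g \<in> borel_measurable \<Omega>" unfolding g_def[abs_def] by (rule integral_mix) (use W in measurable)
  show "\<forall>\<omega>. 0 \<le> g \<omega> \<and> g \<omega> \<le> 1" by (simp add: g_def)
  show "pker W = (\<integral>\<omega>. g \<omega> \<partial>\<Omega>)" unfolding g_def pker_def by (rule integral_mix) (use W in measurable)
  have "AE \<omega> in \<Omega>. \<forall>k. invertible (Amat 1 (shift k \<omega>))" by (rule AE_all_invertible)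
  then show "AE \<omega> in \<Omega>. g \<omega> = pker ((*v) (Amat 1 \<omega>) ` W)"
  proof eventually_elim
    case (elim \<omega>)
    from elim[rule_format, of 0] have inv: "invertible (Amat 1 \<omega>)" by simp
    have "W \<subseteq> Ker (mix {..0} \<omega> \<omega>') \<longleftrightarrow> (*v) (Amat 1 \<omega>) ` W \<subseteq> Ker (shift 1 \<omega>')" for \<omega>'
    proof -
      have A: "Amat 1 (mix {..0} \<omega> \<omega>') = Amat 1 \<omega>" by (simp add: Amat_def mix_def)
      have "Ker (shift 1 (mix {..0} \<omega> \<omega>')) = Ker (shift 1 \<omega>')"
        by (rule Ker_cong) (simp add: shift_def mix_def)
      then show ?thesis using Ker_step[of "mix {..0} \<omega> \<omega>'"] inv A by (auto simp: subset_iff)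
    qed
    then have "g \<omega> = Om.prob (shift 1 -` {\<omega>'. (*v) (Amat 1 \<omega>) ` W \<subseteq> Ker \<omega>'})"
      by (simp add: g_def vimage_def)
    also have "\<dots> = pker ((*v) (Amat 1 \<omega>) ` W)"
      unfolding pker_def
      by (intro prob_shift Ker_subset_measurable invertible_image_subspace inv W)
    finally show ?case .
  qed
qed

text \<open>Furstenberg's argument: among the subspaces of maximal dimension lying in the kernel
  with positive probability, those of maximal probability are finite in number and are permuted
  by almost every matrix.\<close>
lemma not_in_Ker:
  assumes irred: "strongly_irreducible (lawA lam)"
    and proper: "AE \<omega> in \<Omega>. Ker \<omega> \<noteq> UNIV" and x: "x \<noteq> 0"
  shows "AE \<omega> in \<Omega>. x \<notin> Ker \<omega>"
proof (rule ccontr)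
  assume neg: "\<not> ?thesis"
  have sub_span: "span {x} \<subseteq> Ker \<omega> \<longleftrightarrow> x \<in> Ker \<omega>" for \<omega>
    using span_minimal[of "{x}" "Ker \<omega>"] subspace_Ker span_base[of x "{x}"] by blast
  have m [measurable]: "{\<omega>. W \<subseteq> Ker \<omega>} \<in> sets \<Omega>" if "subspace W" for W
    using that by (rule Ker_subset_measurable)
  have "pker (span {x}) \<noteq> 0"
  proof
    assume "pker (span {x}) = 0"
    then have "AE \<omega> in \<Omega>. \<omega> \<notin> {\<omega>. span {x} \<subseteq> Ker \<omega>}"
      unfolding pker_def by (subst (asm) Om.prob_eq_0) (auto intro: m)
    with neg show False by (simp add: sub_span)
  qed
  then have px: "pker (span {x}) > 0" by (simp add: pker_def zero_less_measure_iff)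
  define R where "R = {dim W |W. subspace W \<and> pker W > 0}"
  have finR: "finite R"
    by (rule finite_subset[of _ "{..CARD('d)}"]) (auto simp: R_def intro: order_trans[OF dim_subset_UNIV_cart])
  define r where "r = Max R"
  have rmax: "dim W \<le> r" if "subspace W" "pker W > 0" for W
    unfolding r_def using finR that by (intro Max_ge) (auto simp: R_def)
  have "r \<ge> dim (span {x})" using px by (intro rmax) auto
  then have r1: "r \<ge> 1" using x by (simp add: dim_span)
  have "R \<noteq> {}" using px by (auto simp: R_def)
  from Max_in[OF finR this] obtain W0 where W0: "subspace W0" "dim W0 = r" "pker W0 > 0"
    by (auto simp: R_def r_def)
  define G where "G = {W. subspace W \<and> dim W = r \<and> pker W \<ge> pker W0}"
  have Gsub: "subspace W" "dim W = r" if "W \<in> G" for W using that by (auto simp: G_def)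
  \<comment> \<open>Two different subspaces of dimension \<open>r\<close> span one of larger
    dimension, which by maximality lies in the kernel with probability zero.\<close>
  have disj: "AE \<omega> in \<Omega>. \<not> (W \<subseteq> Ker \<omega> \<and> W' \<subseteq> Ker \<omega>)"
    if W: "subspace W" "dim W = r" "subspace W'" "dim W' = r" "W \<noteq> W'" for W W'
  proof -
    let ?S = "span (W \<union> W')"
    have "dim ?S > r"
    proof (rule ccontr)
      assume "\<not> dim ?S > r"
      then have "dim ?S \<le> r" by simp
      then have "W = ?S" "W' = ?S"
        using W by (intro subspace_dim_equal; auto intro: span_base)+
      with W(5) show False by simp
    qed
    then have "\<not> pker ?S > 0" using rmax[of ?S] by auto
    then have "pker ?S = 0" using measure_nonneg[of \<Omega>] by (simp add: pker_def zero_less_measure_iff)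
    then have "AE \<omega> in \<Omega>. \<omega> \<notin> {\<omega>. ?S \<subseteq> Ker \<omega>}"
      unfolding pker_def by (subst (asm) Om.prob_eq_0) (auto intro: m)
    then show ?thesis
    proof eventually_elim
      case (elim \<omega>)
      then show ?case
        using span_minimal[of "W \<union> W'" "Ker \<omega>"] subspace_Ker by blast
    qed
  qed
  \<comment> \<open>Members of \<open>G\<close> give almost surely disjoint events of probability at
    least \<open>pker W0\<close>, so there are at most \<open>1 / pker W0\<close> of them.\<close>
  have finG: "finite G"
  proof (rule ccontr)
    assume "infinite G"
    then obtain H where H: "H \<subseteq> G" "finite H" "card H = Suc (nat \<lceil>1 / pker W0\<rceil>)"
      using infinite_arbitrarily_large by blast
    have "real (card H) * pker W0 \<le> (\<Sum>W\<in>H. pker W)"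
      using H by (intro sum_bounded_below) (auto simp: G_def)
    also have "\<dots> = Om.prob (\<Union>W\<in>H. {\<omega>. W \<subseteq> Ker \<omega>})"
      unfolding pker_def
    proof (rule measure_UNION_AE[symmetric, OF H(2)])
      show "{\<omega>. W \<subseteq> Ker \<omega>} \<in> fmeasurable \<Omega>" if "W \<in> H" for W
        using m[of W] Gsub[of W] H(1) that by (auto simp: Om.fmeasurable_eq_sets)
      show "pairwise (\<lambda>W W'. AE \<omega> in \<Omega>. \<omega> \<notin> {\<omega>. W \<subseteq> Ker \<omega>} \<or> \<omega> \<notin> {\<omega>. W' \<subseteq> Ker \<omega>}) H"
        unfolding pairwise_def
      proof (intro ballI impI)
        fix W W' assume "W \<in> H" "W' \<in> H" "W \<noteq> W'"
        then have "AE \<omega> in \<Omega>. \<not> (W \<subseteq> Ker \<omega> \<and> W' \<subseteq> Ker \<omega>)"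
          using H(1) Gsub by (intro disj) auto
        then show "AE \<omega> in \<Omega>. \<omega> \<notin> {\<omega>. W \<subseteq> Ker \<omega>} \<or> \<omega> \<notin> {\<omega>. W' \<subseteq> Ker \<omega>}" by simp
      qed
    qed
    also have "\<dots> \<le> 1" by simp
    finally have "real (card H) \<le> 1 / pker W0" using W0(3) by (simp add: field_simps)
    moreover have "1 / pker W0 < real (card H)" unfolding H(3) by linarith
    ultimately show False by simp
  qed
  define M where "M = Max (pker ` G)"
  have "W0 \<in> G" using W0 by (simp add: G_def)
  then have "M \<in> pker ` G" unfolding M_def using finG by (intro Max_in) auto
  then obtain W1 where W1: "W1 \<in> G" "pker W1 = M" by auto
  have "pker W0 \<le> M" unfolding M_def using finG \<open>W0 \<in> G\<close> by (intro Max_ge) auto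
  then have Mmax: "pker W \<le> M" if "subspace W" "dim W = r" for W
  proof (cases "W \<in> G")
    case True
    then show ?thesis unfolding M_def using finG by (intro Max_ge) auto
  qed (use that \<open>pker W0 \<le> M\<close> in \<open>auto simp: G_def\<close>)
  define F where "F = {W \<in> G. pker W = M}"
  have finF: "finite F" using finG by (simp add: F_def)
  have step: "AE \<omega> in \<Omega>. (*v) (Amat 1 \<omega>) ` W \<in> F" if W: "W \<in> F" for W
  proof -
    have sW: "subspace W" "dim W = r" "pker W = M" using W Gsub by (auto simp: F_def)
    obtain g where g [measurable]: "g \<in> borel_measurable \<Omega>" and g01: "\<And>\<omega>. 0 \<le> g \<omega> \<and> g \<omega> \<le> 1"
      and pW: "pker W = (\<integral>\<omega>. g \<omega> \<partial>\<Omega>)" and AEg: "AE \<omega> in \<Omega>. g \<omega> = pker ((*v) (Amat 1 \<omega>) ` W)"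
      using pker_average[OF sW(1)] by blast
    have im: "AE \<omega> in \<Omega>. subspace ((*v) (Amat 1 \<omega>) ` W) \<and> dim ((*v) (Amat 1 \<omega>) ` W) = r"
      using AE_all_invertible
    proof eventually_elim
      case (elim \<omega>)
      from elim[rule_format, of 0] show ?case
        using invertible_image_subspace[of "Amat 1 \<omega>" W] sW by simp
    qed
    have intg: "integrable \<Omega> g"
      using g01 by (intro Om.integrable_const_bound[where B=1]) auto
    \<comment> \<open>Maximum principle: \<open>M\<close> is the mean of values that are at most
      \<open>M\<close>, so these equal \<open>M\<close> almost surely.\<close>
    have nn: "AE \<omega> in \<Omega>. 0 \<le> M - g \<omega>"
      using AEg im by eventually_elim (use Mmax in auto)
    have "(\<integral>\<omega>. M - g \<omega> \<partial>\<Omega>) = 0"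
      using intg pW sW(3) Om.prob_space by simp
    then have "AE \<omega> in \<Omega>. M - g \<omega> = 0"
      using integral_nonneg_eq_0_iff_AE[OF _ nn] intg by simp
    with AEg im show ?thesis
    proof eventually_elim
      case (elim \<omega>)
      then show ?case using \<open>pker W0 \<le> M\<close> by (auto simp: F_def G_def)
    qed
  qed
  have AEF: "AE \<omega> in \<Omega>. \<forall>W\<in>F. (*v) (Amat 1 \<omega>) ` W \<in> F"
    using finF step by (intro AE_finite_allI) auto
  show False
  proof (rule not_invariant_union[OF irred finF])
    show "F \<noteq> {}" using W1 by (auto simp: F_def)
    show "AE \<omega> in \<Omega>. (*v) (Amat 1 \<omega>) ` \<Union>F \<subseteq> \<Union>F"
      using AEF by eventually_elim blast
    fix V assume V: "V \<in> F"
    then have sV: "subspace V" "dim V = r" "pker V \<ge> pker W0" by (auto simp: F_def G_def)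
    moreover have "V \<noteq> {0}" using sV r1 by auto
    moreover have "V \<noteq> UNIV"
    proof
      assume "V = UNIV"
      then have "AE \<omega> in \<Omega>. \<omega> \<notin> {\<omega>. V \<subseteq> Ker \<omega>}" using proper by auto
      then have "pker V = 0" unfolding pker_def by (subst Om.prob_eq_0) (auto intro: m sV)
      with sV(3) W0(3) show False by simp
    qed
    ultimately show "subspace V \<and> V \<noteq> {0} \<and> V \<noteq> UNIV" by simp
  qed
qed

section \<open>The span of the past directions\<close>

text \<open>A minimal subspace containing the direction of the past almost surely is invariant.\<close>
lemma past_directions_span:
  assumes irred: "strongly_irreducible (lawA lam)"
    and past: "AE \<omega> in \<Omega>. direction_of (\<lambda>n. transpose (Sback n \<omega>)) (z \<omega>)"
    and V: "subspace V" "AE \<omega> in \<Omega>. z \<omega> \<in> V"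
  shows "V = UNIV"
proof (rule ccontr)
  assume VU: "V \<noteq> UNIV"
  define P where "P V \<longleftrightarrow> subspace V \<and> (AE \<omega> in \<Omega>. z \<omega> \<in> V)" for V
  have "P V" using V by (simp add: P_def)
  from ex_has_least_nat[where P=P and m=dim, OF this]
  obtain W where W: "P W" "\<And>U. P U \<Longrightarrow> dim W \<le> dim U" by blast
  have sW: "subspace W" and zW: "AE \<omega> in \<Omega>. z \<omega> \<in> W" using W(1) by (auto simp: P_def)
  \<comment> \<open>By equivariance this vector is a multiple of the direction of the shifted
    sample, which lies in \<open>W\<close> as well.\<close>
  have "AE \<omega> in \<Omega>. Amat 1 \<omega> *v z \<omega> \<in> W"
    using past AE_shift[OF past, of 1] AE_shift[OF zW, of 1] AE_all_invertible
  proof eventually_elim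
    case (elim \<omega>)
    from elim(4)[rule_format, of 0] have "invertible (transpose (Amat 1 \<omega>))"
      by (simp add: invertible_transpose)
    moreover have "transpose (Sback (Suc n) (shift 1 \<omega>)) = transpose (Sback n \<omega>) ** transpose (Amat 1 \<omega>)" for n
      by (simp only: Sback_Suc_shift matrix_transpose_mul)
    ultimately obtain c where "c \<noteq> 0" "z (shift 1 \<omega>) = c *\<^sub>R (transpose (transpose (Amat 1 \<omega>)) *v z \<omega>)"
      using elim(2,1) by (rule direction_of_step[where N="\<lambda>n. transpose (Sback n (shift 1 \<omega>))"
        and M="\<lambda>n. transpose (Sback n \<omega>)" and A="transpose (Amat 1 \<omega>)" and v="z (shift 1 \<omega>)" and v'="z \<omega>"])
    then have "Amat 1 \<omega> *v z \<omega> = (1 / c) *\<^sub>R z (shift 1 \<omega>)"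
      by (simp add: transpose_transpose del: transpose_matrix_vector)
    then show ?case using elim(3) sW by (simp add: subspace_mul)
  qed
  \<comment> \<open>Gluing freezes the matrix A_1 of \<omega>' while the past, and with it the
    direction, varies with \<omega>.\<close>
  from AE_mix[OF AE_conjI[OF this past], of "{0..}"]
  have "AE \<omega>' in \<Omega>. (*v) (Amat 1 \<omega>') ` W \<subseteq> W"
  proof eventually_elim
    case (elim \<omega>')
    have "AE \<omega> in \<Omega>. z \<omega> \<in> {v \<in> W. Amat 1 \<omega>' *v v \<in> W}"
      using elim past zW
    proof eventually_elim
      case (elim \<omega>)
      have "Sback n (mix {0..} \<omega>' \<omega>) = Sback n \<omega>" for n
        by (rule Sback_cong) (simp add: mix_def)
      then have "direction_of (\<lambda>n. transpose (Sback n \<omega>)) (z (mix {0..} \<omega>' \<omega>))"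
        using elim(1) by simp
      from direction_of_unique[OF elim(2) this]
      obtain c where "c \<noteq> 0" "z (mix {0..} \<omega>' \<omega>) = c *\<^sub>R z \<omega>" by blast
      moreover have "Amat 1 (mix {0..} \<omega>' \<omega>) = Amat 1 \<omega>'" by (simp add: Amat_def mix_def)
      ultimately have "c *\<^sub>R (Amat 1 \<omega>' *v z \<omega>) \<in> W"
        using elim(1) by (simp add: matrix_vector_mult_scaleR)
      from subspace_mul[OF sW this, of "1 / c"]
      have "(1 / c) *\<^sub>R (c *\<^sub>R (Amat 1 \<omega>' *v z \<omega>)) \<in> W" .
      with \<open>c \<noteq> 0\<close> elim(3) show ?case by simp
    qed
    moreover have sU: "subspace {v \<in> W. Amat 1 \<omega>' *v v \<in> W}"
      using sW by (auto simp: subspace_def matrix_vector_right_distrib matrix_vector_mult_scaleR)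
    ultimately have "P {v \<in> W. Amat 1 \<omega>' *v v \<in> W}" by (simp add: P_def)
    \<comment> \<open>The vectors of \<open>W\<close> whose image stays in \<open>W\<close> form a
      subspace containing the direction almost surely, so minimality of \<open>W\<close>
      applies.\<close>
    from W(2)[OF this] have "{v \<in> W. Amat 1 \<omega>' *v v \<in> W} = W"
      by (intro subspace_dim_equal sU sW) auto
    then show ?case by blast
  qed
  moreover have "W \<noteq> {0}"
  proof
    assume "W = {0}"
    have "AE \<omega> in \<Omega>. False"
      using past zW by eventually_elim (simp add: direction_of_def \<open>W = {0}\<close>)
    then show False by simp
  qed
  moreover have "W \<noteq> UNIV"
  proof
    assume "W = UNIV"
    then have "dim V \<ge> CARD('d)" using W(2)[of V] V by (simp add: P_def)
    then have "V = UNIV" using V(1) by (intro subspace_dim_equal) auto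
    with VU show False by simp
  qed
  ultimately show False
    using not_invariant_union[OF irred, of "{W}"] sW by auto
qed

subsection \<open>Stretching of a fixed vector\<close>

text \<open>Where the future direction exists, this is the length of the component of
  \<open>v\<close> along it. As a limit of norms it is measurable whatever representative of the
  direction is chosen.\<close>

definition stretch :: "(int \<Rightarrow> 'd mat \<times> 'd mat) \<Rightarrow> real^'d \<Rightarrow> real" where
  "stretch \<omega> v = lim (\<lambda>n. norm (Sprod n \<omega> *v v) / norm (Sprod n \<omega>))"

lemma stretch_measurable [measurable]:
  assumes [measurable]: "f \<in> measurable N \<Omega>" "g \<in> borel_measurable N"
  shows "(\<lambda>x. stretch (f x) (g x)) \<in> borel_measurable N"
proof -
  have [measurable]: "(\<lambda>x. Sprod n (f x)) \<in> borel_measurable N" for n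
    using measurable_compose[OF assms(1) matrices_measurable(3)[of n]] .
  show ?thesis unfolding stretch_def by measurable
qed

lemma stretch_direction:
  assumes "direction_of (\<lambda>n. Sprod n \<omega>) v"
  shows "stretch \<omega> w = \<bar>inner v w\<bar> / norm v"
  using assms unfolding stretch_def direction_of_def by (intro limI) auto

lemma stretch_cong: "(\<And>i. 0 \<le> i \<Longrightarrow> \<omega> i = \<omega>' i) \<Longrightarrow> stretch \<omega> v = stretch \<omega>' v"
  using Sprod_cong[of _ \<omega> \<omega>'] by (simp add: stretch_def)

text \<open>The mean stretch \<open>h\<close> is 1-Lipschitz, and positive away from 0 because by
  \<open>not_in_Ker\<close> a fixed nonzero vector is almost never orthogonal to the direction.
  Compactness of the sphere makes the bound uniform in \<open>w\<close>.\<close>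

lemma stretch_nondegenerate:
  assumes irred: "strongly_irreducible (lawA lam)"
    and fut: "AE \<omega> in \<Omega>. direction_of (\<lambda>n. Sprod n \<omega>) (\<zeta> \<omega>)"
  shows "\<exists>\<delta>>0. \<forall>w. \<delta> \<le> Om.prob {\<omega>. \<delta> * norm w \<le> stretch \<omega> w}"
proof -
  have m [measurable]: "(\<lambda>\<omega>. stretch \<omega> w) \<in> borel_measurable \<Omega>" for w by measurable
  have bd: "AE \<omega> in \<Omega>. 0 \<le> stretch \<omega> w \<and> stretch \<omega> w \<le> norm w" for w
    using fut
  proof eventually_elim
    case (elim \<omega>)
    then have "\<zeta> \<omega> \<noteq> 0" by (simp add: direction_of_def)
    then show ?case
      using Cauchy_Schwarz_ineq2[of "\<zeta> \<omega>" w] by (simp add: stretch_direction[OF elim] field_simps)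
  qed
  have int: "integrable \<Omega> (\<lambda>\<omega>. stretch \<omega> w)" for w
    using bd[of w] by (intro Om.integrable_const_bound[where B="norm w"]) (auto elim: eventually_mono)
  define h where "h w = (\<integral>\<omega>. stretch \<omega> w \<partial>\<Omega>)" for w
  have lip: "\<bar>h v - h w\<bar> \<le> norm (v - w)" for v w
  proof -
    have "\<bar>h v - h w\<bar> = \<bar>\<integral>\<omega>. stretch \<omega> v - stretch \<omega> w \<partial>\<Omega>\<bar>"
      by (simp add: h_def int)
    also have "\<dots> \<le> (\<integral>\<omega>. \<bar>stretch \<omega> v - stretch \<omega> w\<bar> \<partial>\<Omega>)"
      by (rule integral_abs_bound)
    also have "\<dots> \<le> (\<integral>\<omega>. norm (v - w) \<partial>\<Omega>)"
    proof (rule integral_mono_AE)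
      show "AE \<omega> in \<Omega>. \<bar>stretch \<omega> v - stretch \<omega> w\<bar> \<le> norm (v - w)"
        using fut
      proof eventually_elim
        case (elim \<omega>)
        then have nz: "norm (\<zeta> \<omega>) > 0" by (simp add: direction_of_def)
        have "\<bar>\<bar>inner (\<zeta> \<omega>) v\<bar> - \<bar>inner (\<zeta> \<omega>) w\<bar>\<bar> \<le> \<bar>inner (\<zeta> \<omega>) (v - w)\<bar>"
          by (simp add: inner_diff_right abs_triangle_ineq3)
        also have "\<dots> \<le> norm (\<zeta> \<omega>) * norm (v - w)" by (rule Cauchy_Schwarz_ineq2)
        finally show ?case
          using nz by (simp add: stretch_direction[OF elim] diff_divide_distrib[symmetric] field_simps)
      qed
    qed (use int in auto)
    also have "\<dots> = norm (v - w)" by (simp add: Om.prob_space[simplified])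
    finally show ?thesis .
  qed
  have pos: "h w > 0" if "w \<noteq> 0" for w
  proof -
    have "AE \<omega> in \<Omega>. Ker \<omega> \<noteq> UNIV"
      using fut
    proof eventually_elim
      case (elim \<omega>)
      have "\<zeta> \<omega> \<notin> Ker \<omega>" using elim
        by (simp add: Ker_def null_directions_direction_of[OF elim] direction_of_def)
      then show ?case by blast
    qed
    from not_in_Ker[OF irred this that] fut
    have pw: "AE \<omega> in \<Omega>. stretch \<omega> w > 0"
    proof eventually_elim
      case (elim \<omega>)
      from elim(2) have "\<zeta> \<omega> \<noteq> 0" by (simp add: direction_of_def)
      with elim(1) show ?case
        by (simp add: Ker_def null_directions_direction_of[OF elim(2)] stretch_direction[OF elim(2)])
    qed
    have nn: "AE \<omega> in \<Omega>. 0 \<le> stretch \<omega> w" using bd[of w] by eventually_elim simp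
    have "h w \<noteq> 0"
    proof
      assume "h w = 0"
      then have "AE \<omega> in \<Omega>. stretch \<omega> w = 0"
        using integral_nonneg_eq_0_iff_AE[OF int nn] by (simp add: h_def)
      with pw have "AE \<omega> in \<Omega>. False" by eventually_elim simp
      then show False by simp
    qed
    moreover have "h w \<ge> 0" unfolding h_def by (rule integral_nonneg_AE[OF nn])
    ultimately show ?thesis by simp
  qed
  have "1-lipschitz_on (sphere 0 1) h"
    by (rule lipschitz_onI) (use lip in \<open>auto simp: dist_norm\<close>)
  then have cont: "continuous_on (sphere 0 1) h" by (rule lipschitz_on_continuous_on)
  have ne: "sphere (0 :: real^'d) 1 \<noteq> {}" by simp
  obtain w0 where w0: "w0 \<in> sphere 0 1" "\<And>w. w \<in> sphere 0 1 \<Longrightarrow> h w0 \<le> h w"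
    using continuous_attains_inf[OF _ ne cont] by auto
  define \<delta> where "\<delta> = h w0 / 2"
  have "w0 \<noteq> 0" using w0(1) by auto
  then have d0: "\<delta> > 0" using pos by (simp add: \<delta>_def)
  have unit: "\<delta> \<le> Om.prob {\<omega>. \<delta> \<le> stretch \<omega> u}" if u: "norm u = 1" for u
  proof -
    have ms: "{\<omega>. \<delta> \<le> stretch \<omega> u} \<in> sets \<Omega>"
      using borel_measurable_const[THEN borel_measurable_le, of "\<lambda>\<omega>. stretch \<omega> u" \<Omega> \<delta>] by simp
    have "2 * \<delta> \<le> h u" using w0(2)[of u] u by (simp add: \<delta>_def)
    \<comment> \<open>The stretch of a unit vector is at most 1 on the event and below \<delta> off
      it. As \<delta> is half the minimum of \<open>h\<close> on the sphere, the other half remains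
      for the probability.\<close>
    also have "h u \<le> (\<integral>\<omega>. indicator {\<omega>. \<delta> \<le> stretch \<omega> u} \<omega> + \<delta> \<partial>\<Omega>)"
      unfolding h_def
    proof (rule integral_mono_AE)
      show "AE \<omega> in \<Omega>. stretch \<omega> u \<le> indicator {\<omega>. \<delta> \<le> stretch \<omega> u} \<omega> + \<delta>"
        using bd[of u] by eventually_elim (use u d0 in \<open>auto simp: indicator_def\<close>)
    qed (use int ms in \<open>auto simp: Om.emeasure_eq_measure intro!: Bochner_Integration.integrable_add integrable_real_indicator\<close>)
    also have "\<dots> = Om.prob {\<omega>. \<delta> \<le> stretch \<omega> u} + \<delta>"
      using ms by (subst Bochner_Integration.integral_add)
        (auto simp: Om.prob_space[simplified] Om.emeasure_eq_measure intro!: integrable_real_indicator)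
    finally show ?thesis by simp
  qed
  have "\<delta> \<le> Om.prob {\<omega>. \<delta> * norm w \<le> stretch \<omega> w}" for w
  proof (cases "w = 0")
    case True
    have "stretch \<omega> 0 = 0" for \<omega> unfolding stretch_def by (intro limI) simp
    then have "{\<omega>. \<delta> * norm w \<le> stretch \<omega> w} = space \<Omega>" using True by auto
    then have "Om.prob {\<omega>. \<delta> * norm w \<le> stretch \<omega> w} = 1" by (simp only: Om.prob_space)
    moreover have "\<delta> \<le> 1" using unit[of w0] w0(1) Om.prob_le_1 order_trans by fastforce
    ultimately show ?thesis by simp
  next
    case False
    define u where "u = (1 / norm w) *\<^sub>R w"
    have "norm u = 1" using False by (simp add: u_def)
    from unit[OF this] have "\<delta> \<le> Om.prob {\<omega>. \<delta> \<le> stretch \<omega> u}" .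
    also have "\<dots> \<le> Om.prob {\<omega>. \<delta> * norm w \<le> stretch \<omega> w}"
    proof (rule Om.finite_measure_mono_AE)
      show "AE \<omega> in \<Omega>. \<omega> \<in> {\<omega>. \<delta> \<le> stretch \<omega> u} \<longrightarrow> \<omega> \<in> {\<omega>. \<delta> * norm w \<le> stretch \<omega> w}"
        using fut
      proof eventually_elim
        case (elim \<omega>)
        have "norm (\<zeta> \<omega>) > 0" "norm w > 0" using elim False by (auto simp: direction_of_def)
        then show ?case
          by (auto simp: stretch_direction[OF elim] u_def abs_mult field_simps)
      qed
      show "{\<omega>. \<delta> * norm w \<le> stretch \<omega> w} \<in> sets \<Omega>"
        using borel_measurable_const[THEN borel_measurable_le, of "\<lambda>\<omega>. stretch \<omega> w" \<Omega> "\<delta> * norm w"] by simp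
    qed
    finally show ?thesis .
  qed
  with d0 show ?thesis by blast
qed

end

section \<open>Linear growth\<close>

locale stationary_directions = random_matrices lam
  for lam :: "(('d::finite) mat \<times> 'd mat) measure" +
  fixes z zt :: "(int \<Rightarrow> 'd mat \<times> 'd mat) \<Rightarrow> real^'d" and \<xi> and E :: real
  assumes irred: "strongly_irreducible (lawA lam)"
    and past: "AE \<omega> in \<Omega>. direction_of (\<lambda>n. transpose (Sback n \<omega>)) (z \<omega>)"
    and fut: "AE \<omega> in \<Omega>. direction_of (\<lambda>n. Sprod n \<omega>) (zt \<omega>)"
    and \<xi>_def: "\<And>\<omega>. \<xi> \<omega> = inner (zt (shift 1 \<omega>)) (Bmat 1 \<omega> *v z \<omega>)
                  / inner (zt (shift 1 \<omega>)) (Amat 1 \<omega> *v z \<omega>)"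
    and E_def: "E = (\<integral>\<omega>. \<xi> \<omega> \<partial>\<Omega>)" and E0: "E \<noteq> 0"
begin

text \<open>Directions at different times of one orbit are compared, so the almost sure properties
  are collected along the whole orbit.\<close>

definition good :: "(int \<Rightarrow> 'd mat \<times> 'd mat) \<Rightarrow> bool" where
  "good \<omega> \<longleftrightarrow> (\<forall>k. invertible (Amat 1 (shift k \<omega>)))
    \<and> (\<forall>k. direction_of (\<lambda>n. transpose (Sback n (shift k \<omega>))) (z (shift k \<omega>)))
    \<and> (\<forall>k. direction_of (\<lambda>n. Sprod n (shift k \<omega>)) (zt (shift k \<omega>)))"

lemma good_directions:
  assumes "good \<omega>"
  shows "direction_of (\<lambda>n. transpose (Sback n \<omega>)) (z \<omega>)" "direction_of (\<lambda>n. Sprod n \<omega>) (zt \<omega>)"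
proof -
  have "direction_of (\<lambda>n. transpose (Sback n (shift 0 \<omega>))) (z (shift 0 \<omega>))"
    "direction_of (\<lambda>n. Sprod n (shift 0 \<omega>)) (zt (shift 0 \<omega>))"
    using assms unfolding good_def by blast+
  then show "direction_of (\<lambda>n. transpose (Sback n \<omega>)) (z \<omega>)" "direction_of (\<lambda>n. Sprod n \<omega>) (zt \<omega>)"
    by simp_all
qed

lemma AE_good: "AE \<omega> in \<Omega>. good \<omega>"
  using AE_all_invertible AE_all_shift[OF past] AE_all_shift[OF fut]
  by eventually_elim (simp add: good_def)

text \<open>The telescoped Birkhoff sum with a free vector in place of \<open>z \<omega>\<close>.
  Rescaling the covector or \<open>v\<close> by a nonzero factor does not change it.\<close>

definition ratio :: "nat \<Rightarrow> (int \<Rightarrow> 'd mat \<times> 'd mat) \<Rightarrow> real^'d \<Rightarrow> real" where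
  "ratio n \<omega> v = inner (zt (shift (int n) \<omega>)) (Tsum n \<omega> *v v)
    / inner (zt (shift (int n) \<omega>)) (Sprod n \<omega> *v v)"

lemma zt_step:
  assumes "good \<omega>"
  shows "\<exists>c. c \<noteq> 0 \<and> zt (shift (int n) \<omega>)
    = c *\<^sub>R (transpose (Amat (Suc n) \<omega>) *v zt (shift (int (Suc n)) \<omega>))"
proof -
  let ?\<omega> = "shift (int n) \<omega>"
  have sh: "shift (int (Suc n)) \<omega> = shift 1 ?\<omega>" by (simp add: shift_shift)
  have inv: "invertible (Amat 1 ?\<omega>)" and dN: "direction_of (\<lambda>m. Sprod m ?\<omega>) (zt ?\<omega>)"
    and dM: "direction_of (\<lambda>m. Sprod m (shift 1 ?\<omega>)) (zt (shift 1 ?\<omega>))"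
    using assms unfolding good_def sh[symmetric] by blast+
  from direction_of_step[OF inv Sprod_Suc_shift dN dM] show ?thesis
    unfolding sh Amat_Suc by blast
qed

lemma z_step:
  assumes "good \<omega>"
  shows "\<exists>b. b \<noteq> 0 \<and> z (shift (int n) \<omega>) = b *\<^sub>R (Sprod n \<omega> *v z \<omega>)"
proof (induction n)
  case 0
  then show ?case by (intro exI[of _ 1]) simp
next
  case (Suc n)
  then obtain b where b: "b \<noteq> 0" "z (shift (int n) \<omega>) = b *\<^sub>R (Sprod n \<omega> *v z \<omega>)" by blast
  let ?\<omega> = "shift (int n) \<omega>"
  have sh: "shift (int (Suc n)) \<omega> = shift 1 ?\<omega>" by (simp add: shift_shift)
  have inv: "invertible (Amat 1 ?\<omega>)" and dM: "direction_of (\<lambda>m. transpose (Sback m ?\<omega>)) (z ?\<omega>)"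
    and dN: "direction_of (\<lambda>m. transpose (Sback m (shift 1 ?\<omega>))) (z (shift 1 ?\<omega>))"
    using assms unfolding good_def sh[symmetric] by blast+
  have st: "transpose (Sback (Suc m) (shift 1 ?\<omega>)) = transpose (Sback m ?\<omega>) ** transpose (Amat 1 ?\<omega>)" for m
    by (simp only: Sback_Suc_shift matrix_transpose_mul)
  from direction_of_step[OF invertible_transpose[OF inv] st dN dM]
  obtain c where c: "c \<noteq> 0" "z (shift 1 ?\<omega>) = c *\<^sub>R (transpose (transpose (Amat 1 ?\<omega>)) *v z ?\<omega>)"
    by blast
  have "z (shift (int (Suc n)) \<omega>) = (c * b) *\<^sub>R (Sprod (Suc n) \<omega> *v z \<omega>)"
    unfolding sh c(2) b(2) Sprod.simps Amat_Suc transpose_transpose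
    by (simp only: matrix_vector_mult_scaleR matrix_vector_mul_assoc scaleR_scaleR)
  with b(1) c(1) show ?case by (intro exI[of _ "c * b"]) auto
qed

lemma sum_\<xi>:
  assumes "good \<omega>"
  shows "(\<Sum>k<n. \<xi> (shift (int k) \<omega>)) = ratio n \<omega> (z \<omega>)"
proof -
  have eq: "\<xi> (shift (int k) \<omega>) = inner (zt (shift (int (Suc k)) \<omega>)) (Bmat (Suc k) \<omega> *v z (shift (int k) \<omega>))
      / inner (zt (shift (int (Suc k)) \<omega>)) (Amat (Suc k) \<omega> *v z (shift (int k) \<omega>))" for k
  proof -
    have "shift (int (Suc k)) \<omega> = shift 1 (shift (int k) \<omega>)" by (simp add: shift_shift)
    then show ?thesis by (simp only: \<xi>_def Amat_Suc Bmat_Suc)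
  qed
  show ?thesis unfolding eq ratio_def
    by (rule sum_increments) (use zt_step[OF assms] z_step[OF assms] in auto)
qed

text \<open>The ergodic theorem gives the limit when direction and matrices come from the same
  sample. The direction depends on the negative coordinates, the rest of the quotient on the others;
  replacing the latter by those of \<omega>' decouples the two.\<close>

lemma ratio_past_limit: "AE \<omega> in \<Omega>. AE \<omega>' in \<Omega>. (\<lambda>n. ratio n \<omega>' (z \<omega>) / real n) \<longlonglongrightarrow> E"
proof -
  have "integrable \<Omega> \<xi>" using E_def E0 not_integrable_integral_eq[of \<Omega> \<xi>] by auto
  from ergodic_average[OF this] AE_good
  have "AE \<omega> in \<Omega>. good \<omega> \<and> (\<lambda>n. ratio n \<omega> (z \<omega>) / real n) \<longlonglongrightarrow> E"
    by eventually_elim (simp add: sum_\<xi> E_def)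
  from AE_mix[OF this, of "{..<0}"] AE_good show ?thesis
  proof eventually_elim
    case (elim \<omega>)
    from elim(1) AE_good show ?case
    proof eventually_elim
      case (elim \<omega>')
      let ?\<eta> = "mix {..<0} \<omega> \<omega>'"
      have "Sback n ?\<eta> = Sback n \<omega>" for n by (rule Sback_cong) (simp add: mix_def)
      moreover have "direction_of (\<lambda>n. transpose (Sback n ?\<eta>)) (z ?\<eta>)"
        "direction_of (\<lambda>n. transpose (Sback n \<omega>)) (z \<omega>)"
        using elim(1) \<open>good \<omega>\<close> good_directions by blast+
      ultimately obtain b where b: "b \<noteq> 0" "z ?\<eta> = b *\<^sub>R z \<omega>"
        using direction_of_unique[of "\<lambda>n. transpose (Sback n \<omega>)" "z \<omega>" "z ?\<eta>"] by auto
      \<comment> \<open>The direction and the covector of the glued sample are nonzero multiples of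
        those of its components, and the quotient ignores such factors.\<close>
      have "ratio n ?\<eta> (z ?\<eta>) = ratio n \<omega>' (z \<omega>)" for n
      proof -
        have "Sprod m (shift (int n) ?\<eta>) = Sprod m (shift (int n) \<omega>')" for m
          by (rule Sprod_cong) (simp add: mix_def shift_def)
        moreover have "direction_of (\<lambda>m. Sprod m (shift (int n) ?\<eta>)) (zt (shift (int n) ?\<eta>))"
          "direction_of (\<lambda>m. Sprod m (shift (int n) \<omega>')) (zt (shift (int n) \<omega>'))"
          using elim unfolding good_def by blast+
        ultimately obtain c where c: "c \<noteq> 0" "zt (shift (int n) ?\<eta>) = c *\<^sub>R zt (shift (int n) \<omega>')"
          using direction_of_unique[of "\<lambda>m. Sprod m (shift (int n) \<omega>')"
              "zt (shift (int n) \<omega>')" "zt (shift (int n) ?\<eta>)"] by auto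
        have "Sprod n ?\<eta> = Sprod n \<omega>'" "Tsum n ?\<eta> = Tsum n \<omega>'"
          by (intro Sprod_cong Tsum_cong; simp add: mix_def)+
        with b c show ?thesis by (simp add: ratio_def matrix_vector_mult_scaleR)
      qed
      with elim(1) show ?case by simp
    qed
  qed
qed

text \<open>The scalar \<open>a n\<close> undoes the transport of the covector from time 0 to time
  \<open>n\<close>: it turns the denominator of \<open>ratio\<close> into
  \<open>inner (zt \<omega>) v\<close>, and the growth can be stated without division by it.\<close>

definition linear_growth :: "(int \<Rightarrow> 'd mat \<times> 'd mat) \<Rightarrow> (nat \<Rightarrow> real) \<Rightarrow> bool" where
  "linear_growth \<omega> a \<longleftrightarrow>
    (\<forall>n v. inner (zt \<omega>) v = a n * inner (zt (shift (int n) \<omega>)) (Sprod n \<omega> *v v)) \<and>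
    (\<forall>v. (\<lambda>n. a n * inner (zt (shift (int n) \<omega>)) (Tsum n \<omega> *v v) / real n) \<longlonglongrightarrow> E * inner (zt \<omega>) v)"

text \<open>Multiplied by \<^term>\<open>inner (zt \<omega>) v\<close>, the ratio becomes linear in \<^term>\<open>v\<close>; so its growth
  is known for all \<^term>\<open>v\<close> once it is known for a spanning set, and typical directions
  \<^term>\<open>z \<omega>\<close> span. Here \<^term>\<open>E \<noteq> 0\<close> excludes \<^term>\<open>inner (zt \<omega>) v = 0\<close>, where the ratio is
  \<^term>\<open>0 / 0\<close>.\<close>
lemma AE_linear_growth: "AE \<omega> in \<Omega>. \<exists>a. linear_growth \<omega> a"
proof -
  define N where "N = {v. AE \<omega> in \<Omega>. (\<lambda>n. ratio n \<omega> v / real n) \<longlonglongrightarrow> E}"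
  have "AE \<omega> in \<Omega>. z \<omega> \<in> span N"
    using ratio_past_limit by eventually_elim (auto simp: N_def intro: span_base)
  then have "span N = UNIV"
    by (intro past_directions_span[OF irred past]) auto
  \<comment> \<open>The exceptional null set depends on \<open>v\<close>, so only finitely many
    vectors of \<open>N\<close> may be used at once.\<close>
  obtain B where B: "B \<subseteq> N" "independent B" "N \<subseteq> span B"
    by (rule maximal_independent_subset)
  have "span N \<subseteq> span B" using B(3) by (intro span_minimal) auto
  then have spB: "span B = UNIV" using \<open>span N = UNIV\<close> by auto
  have finB: "finite B" using B(2) by (rule independent_imp_finite)
  have "AE \<omega> in \<Omega>. \<forall>v\<in>B. (\<lambda>n. ratio n \<omega> v / real n) \<longlonglongrightarrow> E"
    using finB B(1) by (intro AE_finite_allI) (auto simp: N_def)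
  with AE_good show ?thesis
  proof eventually_elim
    case (elim \<omega>)
    have "\<forall>n. \<exists>a. a \<noteq> 0 \<and> (\<forall>v. inner (zt (shift (int 0) \<omega>)) v = a * inner (zt (shift (int n) \<omega>)) (Sprod n \<omega> *v v))"
      using covector_pullback[of "\<lambda>n. zt (shift (int n) \<omega>)" \<omega>] zt_step[OF elim(1)] by blast
    then obtain a where a: "\<And>n v. inner (zt \<omega>) v = a n * inner (zt (shift (int n) \<omega>)) (Sprod n \<omega> *v v)"
      by simp metis
    let ?X = "\<lambda>v n. a n * inner (zt (shift (int n) \<omega>)) (Tsum n \<omega> *v v) / real n"
    let ?U = "{v. ?X v \<longlonglongrightarrow> E * inner (zt \<omega>) v}"
    have "subspace ?U"
    proof (rule subspaceI)
      fix v w assume "v \<in> ?U" "w \<in> ?U"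
      then have "(\<lambda>n. ?X v n + ?X w n) \<longlonglongrightarrow> E * inner (zt \<omega>) v + E * inner (zt \<omega>) w"
        by (intro tendsto_add) auto
      moreover have "?X v n + ?X w n = ?X (v + w) n" for n
        by (simp add: matrix_vector_right_distrib inner_add_right distrib_left add_divide_distrib)
      ultimately show "v + w \<in> ?U" by (simp add: inner_add_right distrib_left)
    next
      fix c v assume "v \<in> ?U"
      then have "(\<lambda>n. c * ?X v n) \<longlonglongrightarrow> c * (E * inner (zt \<omega>) v)"
        by (intro tendsto_mult_left) auto
      moreover have "c * ?X v n = ?X (c *\<^sub>R v) n" for n
        by (simp add: matrix_vector_mult_scaleR)
      ultimately have "?X (c *\<^sub>R v) \<longlonglongrightarrow> c * (E * inner (zt \<omega>) v)" by (simp only:)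
      then show "c *\<^sub>R v \<in> ?U" by (simp only: mem_Collect_eq inner_scaleR_right mult.left_commute)
    qed simp
    moreover have "B \<subseteq> ?U"
    proof
      fix v assume "v \<in> B"
      then have lim: "(\<lambda>n. ratio n \<omega> v / real n) \<longlonglongrightarrow> E" using elim(2) by blast
      have nz: "inner (zt \<omega>) v \<noteq> 0"
      proof
        assume "inner (zt \<omega>) v = 0"
        then have az: "a n = 0 \<or> inner (zt (shift (int n) \<omega>)) (Sprod n \<omega> *v v) = 0" for n
          using a[of v n] by simp
        \<comment> \<open>With \<open>a n\<close> nonzero it is the true denominator that vanishes;
          division by zero then makes the quotient 0 for every \<open>n\<close>.\<close>
        have "a n \<noteq> 0" for n
        proof
          assume "a n = 0"
          then have "inner (zt \<omega>) (zt \<omega>) = 0" using a[of "zt \<omega>" n] by simp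
          then show False using good_directions(2)[OF elim(1)] by (simp add: direction_of_def)
        qed
        with az have "(\<lambda>n. ratio n \<omega> v / real n) = (\<lambda>n. 0)" by (auto simp: ratio_def)
        with lim have "E = 0" by (simp add: LIMSEQ_const_iff)
        with E0 show False by simp
      qed
      have X: "?X v n = ratio n \<omega> v / real n * inner (zt \<omega>) v" for n
        using a[of v n] nz by (auto simp: ratio_def)
      from tendsto_mult_right[OF lim, of "inner (zt \<omega>) v"] show "v \<in> ?U"
        by (simp only: X mem_Collect_eq)
    qed
    ultimately have "span B \<subseteq> ?U" by (intro span_minimal)
    then have "linear_growth \<omega> a" using spB a unfolding linear_growth_def by blast
    then show ?case by blast
  qed
qed

section \<open>The vector-valued deviation from linear growth\<close>

definition deviation :: "real^'d \<Rightarrow> nat \<Rightarrow> (int \<Rightarrow> 'd mat \<times> 'd mat) \<Rightarrow> real^'d" where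
  "deviation x n \<omega> = Tsum n \<omega> *v x - (real n * E) *\<^sub>R (Sprod n \<omega> *v x)"

text \<open>The covector at time \<^term>\<open>n\<close> is independent of the deviation at time \<^term>\<open>n\<close>, so with
  probability bounded below it sees a large deviation when there is one, contradicting
  \<^const>\<open>linear_growth\<close>.\<close>
lemma deviation_small:
  assumes x: "x \<noteq> 0" and e: "e > 0"
  shows "AE \<omega> in \<Omega>. \<forall>\<^sub>F n in sequentially. norm (deviation x n \<omega>) \<le> e * real n * norm (Sprod n \<omega> *v x)"
proof -
  obtain \<delta> where d: "\<delta> > 0" and nondeg: "\<And>w. \<delta> \<le> Om.prob {\<omega>. \<delta> * norm w \<le> stretch \<omega> w}"
    using stretch_nondegenerate[OF irred fut] by blast
  have dev_m [measurable]: "deviation x n \<in> borel_measurable \<Omega>" for n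
    unfolding deviation_def[abs_def] by measurable
  have str_m [measurable]: "(\<lambda>\<omega>. stretch (shift (int n) \<omega>) (deviation x n \<omega>)) \<in> borel_measurable \<Omega>" for n
    by (rule stretch_measurable) measurable
  define C where "C n = {\<omega>. e * real n * norm (Sprod n \<omega> *v x) < norm (deviation x n \<omega>)}" for n
  define D where "D n = {\<omega>. \<delta> * norm (deviation x n \<omega>) \<le> stretch (shift (int n) \<omega>) (deviation x n \<omega>)}" for n
  have C: "C n \<in> sets \<Omega>" for n
  proof -
    have "{\<omega> \<in> space \<Omega>. e * real n * norm (Sprod n \<omega> *v x) < norm (deviation x n \<omega>)} \<in> sets \<Omega>"
      by measurable
    then show ?thesis by (simp add: C_def)
  qed
  have D: "D n \<in> sets \<Omega>" for n
  proof -
    have "{\<omega> \<in> space \<Omega>. \<delta> * norm (deviation x n \<omega>) \<le> stretch (shift (int n) \<omega>) (deviation x n \<omega>)} \<in> sets \<Omega>"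
      by measurable
    then show ?thesis by (simp add: D_def)
  qed
  have "AE \<omega> in \<Omega>. \<forall>\<^sub>F n in sequentially. \<omega> \<notin> C n"
  proof (rule Om.eventually_not_of_first_hit[OF C D d])
    fix m n :: nat
    define F where "F = C n - (\<Union>j\<in>{m..<n}. C j)"
    have F: "F \<in> sets \<Omega>" unfolding F_def using C by auto
    \<comment> \<open>The coordinates below \<open>n\<close> determine S_j and T_j for all j <= n,
      hence the first-hit event; those from \<open>n\<close> on determine the stretch at time
      \<open>n\<close>.\<close>
    let ?mix = "mix {..<int n}"
    have dev_mix: "deviation x j (?mix \<omega> \<omega>') = deviation x j \<omega>" "Sprod j (?mix \<omega> \<omega>') = Sprod j \<omega>"
      if "j \<le> n" for j \<omega> \<omega>'
    proof -
      show S: "Sprod j (?mix \<omega> \<omega>') = Sprod j \<omega>"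
        by (rule Sprod_cong) (use that in \<open>simp add: mix_def\<close>)
      have "Tsum j (?mix \<omega> \<omega>') = Tsum j \<omega>"
        by (rule Tsum_cong) (use that in \<open>simp add: mix_def\<close>)
      with S show "deviation x j (?mix \<omega> \<omega>') = deviation x j \<omega>" by (simp add: deviation_def)
    qed
    have F_mix: "?mix \<omega> \<omega>' \<in> F \<longleftrightarrow> \<omega> \<in> F" for \<omega> \<omega>'
      unfolding F_def C_def by (simp add: dev_mix)
    have D_mix: "?mix \<omega> \<omega>' \<in> D n \<longleftrightarrow> \<delta> * norm (deviation x n \<omega>) \<le> stretch (shift (int n) \<omega>') (deviation x n \<omega>)"
      for \<omega> \<omega>'
    proof -
      have "stretch (shift (int n) (?mix \<omega> \<omega>')) v = stretch (shift (int n) \<omega>') v" for v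
        by (rule stretch_cong) (simp add: shift_def mix_def)
      then show ?thesis by (simp add: D_def dev_mix)
    qed
    \<comment> \<open>Once the past is fixed, the deviation is a constant vector, to which the
      uniform bound \<open>nondeg\<close> applies.\<close>
    have lower: "indicator F \<omega> * \<delta> \<le> Om.prob {\<omega>'. ?mix \<omega> \<omega>' \<in> F \<inter> D n}" for \<omega>
    proof (cases "\<omega> \<in> F")
      case True
      let ?v = "deviation x n \<omega>"
      have ms: "{\<omega>. \<delta> * norm ?v \<le> stretch \<omega> ?v} \<in> sets \<Omega>"
      proof -
        have "{\<omega> \<in> space \<Omega>. \<delta> * norm ?v \<le> stretch \<omega> ?v} \<in> sets \<Omega>" by measurable
        then show ?thesis by simp
      qed
      have "{\<omega>'. ?mix \<omega> \<omega>' \<in> F \<inter> D n} = shift (int n) -` {\<omega>. \<delta> * norm ?v \<le> stretch \<omega> ?v}"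
        using True by (simp add: F_mix D_mix vimage_def)
      then have "Om.prob {\<omega>'. ?mix \<omega> \<omega>' \<in> F \<inter> D n} = Om.prob {\<omega>. \<delta> * norm ?v \<le> stretch \<omega> ?v}"
        using prob_shift[OF ms, of "int n"] by simp
      with nondeg[of ?v] True show ?thesis by simp
    qed simp
    have "\<delta> * Om.prob F = (\<integral>\<omega>. indicator F \<omega> * \<delta> \<partial>\<Omega>)" using F by simp
    also have "\<dots> \<le> (\<integral>\<omega>. Om.prob {\<omega>'. ?mix \<omega> \<omega>' \<in> F \<inter> D n} \<partial>\<Omega>)"
    proof (rule integral_mono)
      show "integrable \<Omega> (\<lambda>\<omega>. indicator F \<omega> * \<delta>)"
        using F by (intro integrable_mult_left integrable_real_indicator) (auto simp: Om.emeasure_eq_measure)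
      show "integrable \<Omega> (\<lambda>\<omega>. Om.prob {\<omega>'. ?mix \<omega> \<omega>' \<in> F \<inter> D n})"
        using F D by (intro Om.integrable_const_bound[where B=1] integral_mix(1)) auto
    qed (rule lower)
    also have "\<dots> = Om.prob (F \<inter> D n)"
      using F D by (intro integral_mix(2)[symmetric]) auto
    finally show "\<delta> * Om.prob (C n - (\<Union>j\<in>{m..<n}. C j)) \<le> Om.prob ((C n - (\<Union>j\<in>{m..<n}. C j)) \<inter> D n)"
      by (simp only: F_def)
  next
    have "AE \<omega> in \<Omega>. Ker \<omega> \<noteq> UNIV"
      using fut
    proof eventually_elim
      case (elim \<omega>)
      have "zt \<omega> \<notin> Ker \<omega>" using elim
        by (simp add: Ker_def null_directions_direction_of[OF elim] direction_of_def)
      then show ?case by blast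
    qed
    from not_in_Ker[OF irred this x] fut AE_good AE_linear_growth
    show "AE \<omega> in \<Omega>. \<forall>\<^sub>F n in sequentially. \<not> (\<omega> \<in> C n \<and> \<omega> \<in> D n)"
    proof eventually_elim
      case (elim \<omega>)
      let ?\<zeta> = "\<lambda>n. zt (shift (int n) \<omega>)"
      let ?p = "inner (zt \<omega>) x"
      have p: "?p \<noteq> 0" using elim(1) null_directions_direction_of[OF elim(2)] by (simp add: Ker_def)
      obtain a where a: "linear_growth \<omega> a" using elim(4) by blast
      let ?X = "\<lambda>n. a n * inner (?\<zeta> n) (Tsum n \<omega> *v x) / real n"
      have "?X \<longlonglongrightarrow> E * ?p" using a by (simp add: linear_growth_def)
      \<comment> \<open>The tolerance is the error that \<open>C n\<close> and \<open>D n\<close>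
        together force: \<delta> from the stretch, \<open>e\<close> from the deviation,
        \<open>?p\<close> from the normalisation by \<open>a n\<close>.\<close>
      then have "\<forall>\<^sub>F n in sequentially. dist (?X n) (E * ?p) < \<delta> * e * \<bar>?p\<bar>"
        using d e p by (intro tendstoD) auto
      then show ?case using eventually_gt_at_top[of 0]
      proof eventually_elim
        case (elim n)
        show ?case
        proof
          assume CD: "\<omega> \<in> C n \<and> \<omega> \<in> D n"
          let ?v = "deviation x n \<omega>" and ?s = "inner (?\<zeta> n) (Sprod n \<omega> *v x)"
          have dir: "direction_of (\<lambda>m. Sprod m (shift (int n) \<omega>)) (?\<zeta> n)"
            using \<open>good \<omega>\<close> by (simp add: good_def)
          then have nz: "norm (?\<zeta> n) > 0" by (simp add: direction_of_def)
          have as: "?p = a n * ?s" using a by (simp add: linear_growth_def)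
          have "\<delta> * norm ?v \<le> \<bar>inner (?\<zeta> n) ?v\<bar> / norm (?\<zeta> n)"
            using CD by (simp add: D_def stretch_direction[OF dir])
          then have 1: "\<delta> * norm ?v * norm (?\<zeta> n) \<le> \<bar>inner (?\<zeta> n) ?v\<bar>"
            using nz by (simp add: field_simps)
          \<comment> \<open>The pairing \<open>?s\<close> is at most the product of the norms, so a
            detected deviation that is large against S_n x is also large against \<open>?s\<close>,
            however small \<open>?s\<close> may be.\<close>
          have "\<delta> * e * real n * \<bar>?s\<bar> \<le> \<delta> * e * real n * (norm (?\<zeta> n) * norm (Sprod n \<omega> *v x))"
            using d e by (intro mult_left_mono Cauchy_Schwarz_ineq2) auto
          also have "\<dots> = \<delta> * norm (?\<zeta> n) * (e * real n * norm (Sprod n \<omega> *v x))" by simp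
          also have "\<dots> \<le> \<delta> * norm (?\<zeta> n) * norm ?v"
            using CD d by (intro mult_left_mono) (auto simp: C_def)
          also have "\<dots> \<le> \<bar>inner (?\<zeta> n) ?v\<bar>" using 1 by (simp add: mult_ac)
          finally have "\<bar>a n\<bar> * (\<delta> * e * real n * \<bar>?s\<bar>) \<le> \<bar>a n\<bar> * \<bar>inner (?\<zeta> n) ?v\<bar>"
            by (rule mult_left_mono) simp
          then have 2: "\<delta> * e * real n * \<bar>?p\<bar> \<le> \<bar>a n * inner (?\<zeta> n) ?v\<bar>"
            unfolding as by (simp add: abs_mult mult_ac)
          have "a n * inner (?\<zeta> n) ?v = real n * (?X n - E * ?p)"
            using elim(2) unfolding as by (simp add: deviation_def inner_diff_right algebra_simps)
          then have "\<delta> * e * real n * \<bar>?p\<bar> \<le> real n * \<bar>?X n - E * ?p\<bar>"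
            using 2 by (simp add: abs_mult)
          then have "real n * (\<delta> * e * \<bar>?p\<bar>) \<le> real n * \<bar>?X n - E * ?p\<bar>" by (simp add: mult_ac)
          then have "\<delta> * e * \<bar>?p\<bar> \<le> \<bar>?X n - E * ?p\<bar>"
            using elim(2) by (subst (asm) mult_le_cancel_left_pos) auto
          with elim(1) show False by (simp add: dist_real_def)
        qed
      qed
    qed
  qed
  then show ?thesis
    by eventually_elim (simp add: C_def not_less)
qed

text \<open>The deviation is o(n |S_n x|), so its inner product with S_n x is negligible against n
  |S_n x|^2.\<close>

theorem derivative_growth:
  assumes x: "x \<noteq> 0"
  shows "AE \<omega> in \<Omega>.
    (\<lambda>n. (1 / real n) * (inner (Sprod n \<omega> *v x) (Tsum n \<omega> *v x) / (norm (Sprod n \<omega> *v x))\<^sup>2)) \<longlonglongrightarrow> E"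
proof -
  have "AE \<omega> in \<Omega>. \<forall>j::nat. \<forall>\<^sub>F n in sequentially.
      norm (deviation x n \<omega>) \<le> (1 / real (Suc j)) * real n * norm (Sprod n \<omega> *v x)"
    unfolding AE_all_countable by (intro allI deviation_small x) simp
  with AE_good show ?thesis
  proof eventually_elim
    case (elim \<omega>)
    let ?s = "\<lambda>n. Sprod n \<omega> *v x"
    let ?g = "\<lambda>n. (1 / real n) * (inner (?s n) (Tsum n \<omega> *v x) / (norm (?s n))\<^sup>2)"
    show ?case
    proof (rule tendstoI)
      fix e :: real assume "e > 0"
      then obtain j where j: "1 / real (Suc j) < e" using nat_approx_posE by blast
      from elim(2)[rule_format, of j] eventually_gt_at_top[of 0]
      show "\<forall>\<^sub>F n in sequentially. dist (?g n) E < e"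
      proof eventually_elim
        case (elim n)
        have "invertible (Sprod n \<omega>)"
          using \<open>good \<omega>\<close> by (intro invertible_Sprod) (simp add: good_def)
        then have s: "norm (?s n) > 0" using x by (simp add: invertible_mult_eq_0_iff)
        have n: "real n > 0" using elim(2) by simp
        have eq: "?g n - E = inner (?s n) (deviation x n \<omega>) / (real n * (norm (?s n))\<^sup>2)"
          using s n by (simp add: deviation_def inner_diff_right dot_square_norm field_simps)
        have "\<bar>inner (?s n) (deviation x n \<omega>)\<bar> \<le> norm (?s n) * norm (deviation x n \<omega>)"
          by (rule Cauchy_Schwarz_ineq2)
        also have "\<dots> \<le> norm (?s n) * ((1 / real (Suc j)) * real n * norm (?s n))"
          using elim(1) by (intro mult_left_mono) auto
        also have "\<dots> = (1 / real (Suc j)) * (real n * (norm (?s n))\<^sup>2)"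
          by (simp add: power2_eq_square)
        finally have "\<bar>?g n - E\<bar> \<le> 1 / real (Suc j)"
          using s n unfolding eq by (simp add: abs_divide pos_divide_le_eq)
        with j show ?case by (simp add: dist_real_def)
      qed
    qed
  qed
qed

end

theorem theorem9p1:
  fixes lam :: "(('d::finite) mat \<times> 'd mat) measure"
    and z zt :: "(int \<Rightarrow> 'd mat \<times> 'd mat) \<Rightarrow> real^'d"
    and x :: "real^'d"
  defines "\<Omega> \<equiv> PiM (UNIV :: int set) (\<lambda>_. lam)"
    and "\<xi> \<equiv> (\<lambda>\<omega>. inner (zt (shift 1 \<omega>)) (Bmat 1 \<omega> *v z \<omega>)
                  / inner (zt (shift 1 \<omega>)) (Amat 1 \<omega> *v z \<omega>))"
  assumes lam_prob: "prob_space lam"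
    and lam_sets: "sets lam = sets borel"
    and lam_GL: "AE p in lam. invertible (fst p)"
    and irred: "strongly_irreducible (lawA lam)"
    and contr: "contracting (lawA lam)"
    and FE2: "(\<integral>\<^sup>+ p. ennreal (opnorm (snd p ** matrix_inv (fst p))) \<partial>lam) < \<infinity>"
    and FE4: "\<exists>\<tau>>0. (\<integral>\<^sup>+ p. ennreal (exp (\<tau> * ell (fst p))) \<partial>lam) < \<infinity>"
    and Zdir: "AE \<omega> in \<Omega>. z \<omega> \<noteq> 0 \<and>
                 limits_rank_one_onto (\<lambda>n. (1 / norm (Sprod n (shift (- int n) \<omega>))) *\<^sub>R Sprod n (shift (- int n) \<omega>)) (z \<omega>)"
    and Ztdir: "AE \<omega> in \<Omega>. zt \<omega> \<noteq> 0 \<and>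
                 limits_rank_one_onto (\<lambda>n. (1 / norm (Sprod n \<omega>)) *\<^sub>R transpose (Sprod n \<omega>)) (zt \<omega>)"
    and Exi: "(\<integral>\<omega>. \<xi> \<omega> \<partial>\<Omega>) \<noteq> 0"
    and x0: "x \<noteq> 0"
  shows "AE \<omega> in \<Omega>.
           (\<lambda>n. (1 / real n) * (inner (Sprod n \<omega> *v x) (Tsum n \<omega> *v x) / (norm (Sprod n \<omega> *v x))\<^sup>2))
             \<longlonglongrightarrow> (\<integral>\<omega>. \<xi> \<omega> \<partial>\<Omega>)"
proof -
  interpret random_matrices lam
    by (rule random_matrices.intro[OF lam_prob lam_sets lam_GL])
  \<comment> \<open>The limit points have range spanned by \<open>z \<omega>\<close>, so their
    transposes have its orthogonal complement as kernel; \<open>direction_of\<close> records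
    kernels, hence the transpose.\<close>
  have past: "AE \<omega> in \<Omega>. direction_of (\<lambda>n. transpose (Sback n \<omega>)) (z \<omega>)"
    using Zdir AE_all_invertible unfolding \<Omega>_def
  proof eventually_elim
    case (elim \<omega>)
    have "Sback n \<omega> \<noteq> 0" for n
      using elim(2) by (intro invertible_imp_nonzero invertible_Sback) blast
    then show ?case
      using elim(1) by (intro direction_of_limits_rank_one) (auto simp: Sback_def)
  qed
  \<comment> \<open>Here the ranges are known for the transposed products, so the kernels are those
    of the products themselves.\<close>
  have fut: "AE \<omega> in \<Omega>. direction_of (\<lambda>n. Sprod n \<omega>) (zt \<omega>)"
    using Ztdir AE_all_invertible unfolding \<Omega>_def
  proof eventually_elim
    case (elim \<omega>)
    have "Sprod n \<omega> \<noteq> 0" for n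
      using elim(2) by (intro invertible_imp_nonzero invertible_Sprod) blast
    then show ?case
      using elim(1) by (intro direction_of_transpose_limits_rank_one) auto
  qed
  interpret stationary_directions lam z zt \<xi> "\<integral>\<omega>. \<xi> \<omega> \<partial>\<Omega>"
    by unfold_locales
      (rule irred past[unfolded \<Omega>_def] fut[unfolded \<Omega>_def] Exi | simp add: \<Omega>_def \<xi>_def)+
  from derivative_growth[OF x0] show ?thesis by (simp only: \<Omega>_def)
qed

end
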